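(* Let $\mathcal{Q}$ be a finite classical polar space of rank $r$, type $Q$ and parameter $\epsilon$ over $\mathbb{F}_q$, and let $D$ be a $t$-$(r,k,\lambda)_Q$ design in $\mathcal{Q}$ of strength $t\ge 2$. Let $\lambda_0=\#D$ be the number of blocks. If $k<r$, then $$\lambda_0\ge\begin{bmatrix} r\\ 1\end{bmatrix}_Q,$$ i.e. the number of blocks is greater than or equal to the number of points of the polar space. If $k=r$, then $$\lambda_0\ge 1+m_1,\qquad\text{where}\quad m_1=q^{\epsilon+1}\cdot\frac{q^{r+\epsilon-1}+1}{q^{\epsilon}+1}\cdot\frac{q^r-1}{q-1}.$$
   Context: Let $q$ be a prime power. A finite classical polar space $\mathcal{Q}$ over $\mathbb{F}_q$ consists of all subspaces of a finite-dimensional $\mathbb{F}_q$-vector space $V$, $n=\dim V$, that are totally isotropic (resp. totally singular) with respect to a non-degenerate alternating or Hermitian form (resp. a non-singular quadratic form) on $V$. All dimensions are vector space dimensions. The rank $r\ge 1$ is the maximal dimension of a subspace in $\mathcal{Q}$; points are the 1-dimensional subspaces in $\mathcal{Q}$. The type $Q$ of $\mathcal{Q}$ (kind of form together with $q$) and its parameter $\epsilon$ are: symplectic $\mathrm{Sp}(q)$ ($n=2r$, $\epsilon=0$); Hermitian $U^+(q)$ ($q$ a square, $n=2r$, $\epsilon=-1/2$); Hermitian $U^-(q)$ ($q$ a square, $n=2r+1$, $\epsilon=1/2$); hyperbolic $\Omega^+(q)$ ($n=2r$, $\epsilon=-1$); parabolic $\Omega(q)$ ($n=2r+1$, $\epsilon=0$);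 elliptic $\Omega^-(q)$ ($n=2r+2$, $\epsilon=1$). $\begin{bmatrix} r\\ 1\end{bmatrix}_Q=\frac{q^r-1}{q-1}(q^{r+\epsilon}+1)$ is the number of points of $\mathcal{Q}$. For $t,k\in\{0,\ldots,r\}$ and an integer $\lambda\ge 0$, a $t$-$(r,k,\lambda)_Q$ design in $\mathcal{Q}$ is a set $D$ of $k$-dimensional subspaces of $\mathcal{Q}$ (called blocks) such that every $t$-dimensional subspace of $\mathcal{Q}$ is contained in exactly $\lambda$ elements of $D$; $t$ is called its strength. The number $m_1$ is the multiplicity of the eigenvalue $q^{r-1}-1$ of the adjacency matrix of the collinearity graph of $\mathcal{Q}$ (vertices: points of $\mathcal{Q}$; two distinct points adjacent if the line they span is in $\mathcal{Q}$).
   Formalization: The design is assumed to have λ ≥ 1; for λ = 0, which the definition allows, the claim fails, since the empty set of blocks is a t-(r,k,0) design with no blocks. *)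

theory Defs
  imports "HOL-Library.Cardinality" "Jordan_Normal_Form.Char_Poly"
begin

datatype polar_type =
    Symplectic            (* Sp(q) *)
  | Hermitian_plus        (* U^+(q) *)
  | Hermitian_minus       (* U^-(q) *)
  | Hyperbolic            (* Omega^+(q) *)
  | Parabolic             (* Omega(q) *)
  | Elliptic              (* Omega^-(q) *)

fun polar_eps :: "polar_type \<Rightarrow> real" where
  "polar_eps Symplectic = 0"
| "polar_eps Hermitian_plus = - 1 / 2"
| "polar_eps Hermitian_minus = 1 / 2"
| "polar_eps Hyperbolic = - 1"
| "polar_eps Parabolic = 0"
| "polar_eps Elliptic = 1"

fun ambient_dim :: "polar_type \<Rightarrow> nat \<Rightarrow> nat" where
  "ambient_dim Symplectic r = 2 * r"
| "ambient_dim Hermitian_plus r = 2 * r"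
| "ambient_dim Hermitian_minus r = 2 * r + 1"
| "ambient_dim Hyperbolic r = 2 * r"
| "ambient_dim Parabolic r = 2 * r + 1"
| "ambient_dim Elliptic r = 2 * r + 2"

locale finite_field_space =
  finite_dimensional_vector_space scale Basis
  for scale :: "'a::{field,finite} \<Rightarrow> 'v::ab_group_add \<Rightarrow> 'v" and Basis :: "'v set"
begin

definition bilinear_form :: "('v \<Rightarrow> 'v \<Rightarrow> 'a) \<Rightarrow> bool" where
  "bilinear_form B \<longleftrightarrow>
     (\<forall>x. Vector_Spaces.linear scale (*) (\<lambda>y. B x y)) \<and>
     (\<forall>y. Vector_Spaces.linear scale (*) (\<lambda>x. B x y))"

definition alternating_form :: "('v \<Rightarrow> 'v \<Rightarrow> 'a) \<Rightarrow> bool" where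
  "alternating_form B \<longleftrightarrow> bilinear_form B \<and> (\<forall>x. B x x = 0)"

(* The involution x |-> x ^ q0 is conjugation on the field with q0^2 elements;
   in particular such a form requires the field order to be a square. *)
definition hermitian_form :: "('v \<Rightarrow> 'v \<Rightarrow> 'a) \<Rightarrow> bool" where
  "hermitian_form h \<longleftrightarrow>
     (\<forall>y. Vector_Spaces.linear scale (*) (\<lambda>x. h x y)) \<and>
     (\<exists>q0. q0 ^ 2 = CARD('a) \<and> (\<forall>x y. h y x = h x y ^ q0))"

definition nondegenerate :: "('v \<Rightarrow> 'v \<Rightarrow> 'a) \<Rightarrow> bool" where
  "nondegenerate B \<longleftrightarrow> (\<forall>x. (\<forall>y. B x y = 0) \<longrightarrow> x = 0)"

definition polarization :: "('v \<Rightarrow> 'a) \<Rightarrow> 'v \<Rightarrow> 'v \<Rightarrow> 'a" where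
  "polarization f x y = f (x + y) - f x - f y"

definition quadratic_form :: "('v \<Rightarrow> 'a) \<Rightarrow> bool" where
  "quadratic_form f \<longleftrightarrow>
     (\<forall>c x. f (scale c x) = c ^ 2 * f x) \<and> bilinear_form (polarization f)"

(* Only the singular vectors of the radical of the polarization have to vanish:
   over a field of even order and in odd dimension that radical is never zero. *)
definition nonsingular :: "('v \<Rightarrow> 'a) \<Rightarrow> bool" where
  "nonsingular f \<longleftrightarrow> (\<forall>x. f x = 0 \<and> (\<forall>y. polarization f x y = 0) \<longrightarrow> x = 0)"

definition totally_isotropic_subspaces :: "('v \<Rightarrow> 'v \<Rightarrow> 'a) \<Rightarrow> 'v set set" where
  "totally_isotropic_subspaces B = {U. subspace U \<and> (\<forall>x\<in>U. \<forall>y\<in>U. B x y = 0)}"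

definition totally_singular_subspaces :: "('v \<Rightarrow> 'a) \<Rightarrow> 'v set set" where
  "totally_singular_subspaces f = {U. subspace U \<and> (\<forall>x\<in>U. f x = 0)}"

(* The three quadratic (and the two Hermitian) types are told apart by the
   relation between rank and ambient dimension, see finite_classical_polar_space. *)
fun subspaces_of_form_kind :: "polar_type \<Rightarrow> 'v set set \<Rightarrow> bool" where
  "subspaces_of_form_kind Symplectic \<Q> \<longleftrightarrow>
     (\<exists>B. alternating_form B \<and> nondegenerate B \<and> \<Q> = totally_isotropic_subspaces B)"
| "subspaces_of_form_kind Hermitian_plus \<Q> \<longleftrightarrow>
     (\<exists>h. hermitian_form h \<and> nondegenerate h \<and> \<Q> = totally_isotropic_subspaces h)"
| "subspaces_of_form_kind Hermitian_minus \<Q> \<longleftrightarrow>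
     (\<exists>h. hermitian_form h \<and> nondegenerate h \<and> \<Q> = totally_isotropic_subspaces h)"
| "subspaces_of_form_kind Hyperbolic \<Q> \<longleftrightarrow>
     (\<exists>f. quadratic_form f \<and> nonsingular f \<and> \<Q> = totally_singular_subspaces f)"
| "subspaces_of_form_kind Parabolic \<Q> \<longleftrightarrow>
     (\<exists>f. quadratic_form f \<and> nonsingular f \<and> \<Q> = totally_singular_subspaces f)"
| "subspaces_of_form_kind Elliptic \<Q> \<longleftrightarrow>
     (\<exists>f. quadratic_form f \<and> nonsingular f \<and> \<Q> = totally_singular_subspaces f)"

definition polar_rank :: "'v set set \<Rightarrow> nat" where
  "polar_rank \<Q> = Max (dim ` \<Q>)"

definition polar_points :: "'v set set \<Rightarrow> 'v set set" where
  "polar_points \<Q> = {P \<in> \<Q>. dim P = 1}"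

definition collinear :: "'v set set \<Rightarrow> 'v set \<Rightarrow> 'v set \<Rightarrow> bool" where
  "collinear \<Q> P P' \<longleftrightarrow> P \<noteq> P' \<and> span (P \<union> P') \<in> \<Q>"

(* Rows and columns follow some enumeration of the points; another enumeration
   gives a permutation-similar matrix, so the characteristic polynomial does not
   depend on the choice. *)
definition collinearity_matrix :: "'v set set \<Rightarrow> real mat" where
  "collinearity_matrix \<Q> =
     (let ps = (SOME ps. distinct ps \<and> set ps = polar_points \<Q>)
      in mat (length ps) (length ps)
           (\<lambda>(i, j). if collinear \<Q> (ps ! i) (ps ! j) then 1 else 0))"

definition polar_m1 :: "'v set set \<Rightarrow> nat" where
  "polar_m1 \<Q> =
     Polynomial.order (real CARD('a) ^ (polar_rank \<Q> - 1) - 1)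
       (char_poly (collinearity_matrix \<Q>))"

definition polar_design ::
    "'v set set \<Rightarrow> nat \<Rightarrow> nat \<Rightarrow> nat \<Rightarrow> nat \<Rightarrow> 'v set set \<Rightarrow> bool" where
  "polar_design \<Q> t r k lam D \<longleftrightarrow>
     t \<le> r \<and> k \<le> r \<and> D \<subseteq> {U \<in> \<Q>. dim U = k} \<and>
     (\<forall>T\<in>\<Q>. dim T = t \<longrightarrow> card {U \<in> D. T \<subseteq> U} = lam)"

end

locale finite_classical_polar_space =
  finite_field_space scale Basis
  for scale :: "'a::{field,finite} \<Rightarrow> 'v::ab_group_add \<Rightarrow> 'v" and Basis :: "'v set" +
  fixes ty :: polar_type and r :: nat and \<Q> :: "'v set set"
  assumes form_kind: "subspaces_of_form_kind ty \<Q>"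
    and dim_ambient: "dim UNIV = ambient_dim ty r"
    and rank: "polar_rank \<Q> = r"
    and rank_pos: "r \<ge> 1"

(* The bracket with upper entry r and lower entry 1 of type ty. *)
definition polar_bracket1 :: "nat \<Rightarrow> polar_type \<Rightarrow> nat \<Rightarrow> real" where
  "polar_bracket1 q ty r =
     (real q ^ r - 1) / (real q - 1) * (real q powr (real r + polar_eps ty) + 1)"

end

theory Submission
  imports
    Defs
    "Jordan_Normal_Form.Schur_Decomposition"
    "HOL-Algebra.Sylow"
    "HOL-Algebra.Multiplicative_Group"
begin

text \<open>
  Let \<open>N\<close> be the incidence matrix of points and blocks. A design of strength at least 2 is also a
  1-design and a 2-design, so \<open>N N\<^sup>T = (l1 - l2) I + l2 M\<close>, where \<open>M\<close> is the perpendicularity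
  matrix of the points and \<open>l1\<close>, \<open>l2\<close> are the numbers of blocks through a point and through a line.
  The matrix \<open>M\<close> has three eigenvalues; those of \<open>N N\<^sup>T\<close> on the first two eigenspaces
  (of dimensions 1 and \<open>m1\<close>) are positive, and the third is \<open>l1 - l2 (1 + q powr (r + \<epsilon> - 1))\<close>,
  which vanishes for \<open>k = r\<close> and is positive for \<open>k < r\<close>. As the rank of \<open>N N\<^sup>T\<close> is at most the
  number of blocks, the bounds follow.

  The parameters of the graph all come from one count, uniform in the type: if \<open>S\<close> is totally
  singular of dimension \<open>s\<close>, then \<open>perp S\<close> contains \<open>q ^ r + e q ^ (r - s) - e\<close> singular vectors,
  where \<open>e = q powr (r + \<epsilon>)\<close>. It is obtained by counting singular vectors in the cosets of \<open>S\<close>,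
  and comparing with a maximal totally singular subspace, whose perp has no further singular vectors.
\<close>

section \<open>Matrices with three eigenvalues\<close>

lemma order_prod_list_linear:
  "Polynomial.order x (\<Prod>e\<leftarrow>es. [:- e, 1:]) = count_list es (x :: 'a :: idom)"
proof (induction es)
  case (Cons e es)
  have nz: "(\<Prod>e\<leftarrow>es. [:- e, 1:]) \<noteq> 0"
    by (auto simp: prod_list_zero_iff)
  have "Polynomial.order x [:- e, 1:] = of_bool (e = x)"
    using order_power_n_n[of e 1] by (auto intro: order_0I)
  then show ?case
    using nz Cons by (auto simp: order_mult simp del: mult_pCons_left)
qed (auto intro: order_0I)

lemma mat_trace_mult_comm:
  assumes "A \<in> carrier_mat n m" "B \<in> carrier_mat m n"
  shows "(\<Sum>i<n. (A * B) $$ (i, i)) = (\<Sum>i<m. (B * A) $$ (i, i :: nat) :: 'a :: comm_semiring_0)"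
proof -
  have "(\<Sum>i<n. (A * B) $$ (i, i)) = (\<Sum>i<n. \<Sum>j<m. A $$ (i, j) * B $$ (j, i))"
    using assms by (auto simp: scalar_prod_def atLeast0LessThan)
  also have "\<dots> = (\<Sum>j<m. \<Sum>i<n. B $$ (j, i) * A $$ (i, j))"
    by (subst sum.swap) (simp add: mult.commute)
  also have "\<dots> = (\<Sum>i<m. (B * A) $$ (i, i))"
    using assms by (auto simp: scalar_prod_def atLeast0LessThan)
  finally show ?thesis .
qed

lemma mat_trace_similar:
  assumes "similar_mat_wit A B P Q" "A \<in> carrier_mat n n"
  shows "(\<Sum>i<n. A $$ (i, i)) = (\<Sum>i<n. B $$ (i, i) :: 'a :: comm_ring_1)"
proof -
  note sim = similar_mat_witD2[OF assms(2,1)]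
  have "(\<Sum>i<n. A $$ (i, i)) = (\<Sum>i<n. (P * (B * Q)) $$ (i, i))"
    using sim by simp
  also have "\<dots> = (\<Sum>i<n. (B * Q * P) $$ (i, i))"
    using sim by (intro mat_trace_mult_comm) auto
  also have "B * Q * P = B"
    using sim by (subst assoc_mult_mat) auto
  finally show ?thesis .
qed

lemma split_char_poly_traces:
  fixes A :: "real mat"
  assumes A: "A \<in> carrier_mat n n"
    and cp: "char_poly A = (\<Prod>e\<leftarrow>es. [:- e, 1:])"
  shows "(\<Sum>i<n. A $$ (i, i)) = sum_list es"
    and "(\<Sum>i<n. (A * A) $$ (i, i)) = (\<Sum>e\<leftarrow>es. e\<^sup>2)"
    and "length es = n"
proof -
  obtain B P Q where "schur_decomposition A es = (B, P, Q)"
    by (cases "schur_decomposition A es") auto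
  from schur_decomposition[OF A cp this]
  have sim: "similar_mat_wit A B P Q" and ut: "upper_triangular B" and diag: "diag_mat B = es"
    by auto
  note sim2 = similar_mat_witD2[OF A sim]
  have B: "B \<in> carrier_mat n n"
    using sim2 by auto
  then show len: "length es = n"
    unfolding diag[symmetric] by (auto simp: diag_mat_def)
  have nth: "es ! i = B $$ (i, i)" if "i < n" for i
    using that B unfolding diag[symmetric] by (auto simp: diag_mat_def)
  have "(\<Sum>i<n. A $$ (i, i)) = (\<Sum>i<n. es ! i)"
    using mat_trace_similar[OF sim A] nth by simp
  then show "(\<Sum>i<n. A $$ (i, i)) = sum_list es"
    by (simp add: sum_list_sum_nth len atLeast0LessThan)
  have "similar_mat_wit (A ^\<^sub>m 2) (B ^\<^sub>m 2) P Q"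
    by (rule similar_mat_wit_pow[OF sim])
  then have "similar_mat_wit (A * A) (B * B) P Q"
    using A B by (simp add: numeral_2_eq_2)
  from mat_trace_similar[OF this, of n]
  have "(\<Sum>i<n. (A * A) $$ (i, i)) = (\<Sum>i<n. (B * B) $$ (i, i))"
    using A by auto
  also have "\<dots> = (\<Sum>i<n. (es ! i)\<^sup>2)"
  proof (intro sum.cong refl)
    fix i assume i: "i \<in> {..<n}"
    then have "(B * B) $$ (i, i) = (\<Sum>j<n. B $$ (i, j) * B $$ (j, i))"
      using B by (auto simp: scalar_prod_def atLeast0LessThan)
    also have "\<dots> = (\<Sum>j<n. if j = i then (es ! i)\<^sup>2 else 0)"
    proof (intro sum.cong refl)
      fix j assume "j \<in> {..<n}"
      then show "B $$ (i, j) * B $$ (j, i) = (if j = i then (es ! i)\<^sup>2 else 0)"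
        using i B nth upper_triangularD[OF ut, of i j] upper_triangularD[OF ut, of j i]
        by (cases i j rule: linorder_cases) (auto simp: power2_eq_square)
    qed
    finally show "(B * B) $$ (i, i) = (es ! i)\<^sup>2"
      using i by simp
  qed
  finally show "(\<Sum>i<n. (A * A) $$ (i, i)) = (\<Sum>e\<leftarrow>es. e\<^sup>2)"
    by (simp add: sum_list_sum_nth len atLeast0LessThan)
qed

lemma char_poly_splits_if_eigenvalues_real:
  fixes A :: "real mat"
  assumes A: "A \<in> carrier_mat n n"
    and ev: "\<And>e. eigenvalue (map_mat complex_of_real A) e \<Longrightarrow> e \<in> complex_of_real ` S"
  shows "\<exists>es. char_poly A = (\<Prod>e\<leftarrow>es. [:- e, 1:]) \<and> set es \<subseteq> S"
proof -
  let ?A = "map_mat complex_of_real A"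
  have A': "?A \<in> carrier_mat n n"
    using A by auto
  obtain es where es: "char_poly ?A = (\<Prod>e\<leftarrow>es. [:- e, 1:])"
    using char_poly_factorized[OF A'] by blast
  have "e \<in> complex_of_real ` S" if "e \<in> set es" for e
  proof (rule ev)
    have "poly (char_poly ?A) e = 0"
      using that unfolding es by (induction es) auto
    then show "eigenvalue ?A e"
      using eigenvalue_root_char_poly[OF A'] by simp
  qed
  then have "\<exists>rs. es = map complex_of_real rs \<and> set rs \<subseteq> S"
  proof (induction es)
    case (Cons e es)
    then obtain rs where "es = map complex_of_real rs" "set rs \<subseteq> S"
      by auto
    moreover obtain r where "e = complex_of_real r" "r \<in> S"
      using Cons.prems by auto
    ultimately show ?case
      by (intro exI[of _ "r # rs"]) auto
  qed auto
  then obtain rs where rs: "es = map complex_of_real rs" "set rs \<subseteq> S"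
    by blast
  have "map_poly complex_of_real (char_poly A) = (\<Prod>e\<leftarrow>es. [:- e, 1:])"
    using of_real_hom.char_poly_hom[OF A, where 'a = complex] es by simp
  also have "\<dots> = map_poly complex_of_real (\<Prod>e\<leftarrow>rs. [:- e, 1:])"
  proof -
    interpret poly_hom: map_poly_comm_ring_hom complex_of_real ..
    show ?thesis
      unfolding rs(1) by (induction rs) (simp_all add: poly_hom.hom_mult del: mult_pCons_left)
  qed
  finally have "char_poly A = (\<Prod>e\<leftarrow>rs. [:- e, 1:])"
    by (metis (no_types, lifting) coeff_map_poly of_real_0 of_real_eq_iff poly_eqI)
  with rs(2) show ?thesis
    by blast
qed

text \<open>Here \<open>M\<close> is the adjacency matrix plus the identity of a strongly regular graph with
  eigenvalues \<open>k\<close>, \<open>a\<close>, \<open>b\<close>; the relation \<open>M_sq\<close> says \<open>(M - a I) (M - b I) = c J\<close>.\<close>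

locale three_eigenvalue_relation =
  fixes X :: "'p set" and M :: "'p \<Rightarrow> 'p \<Rightarrow> real" and a b c k :: real
  assumes finite_X: "finite X" and nonempty_X: "X \<noteq> {}"
    and M_sym: "x \<in> X \<Longrightarrow> y \<in> X \<Longrightarrow> M x y = M y x"
    and M_01: "x \<in> X \<Longrightarrow> y \<in> X \<Longrightarrow> M x y \<in> {0, 1}"
    and M_diag: "x \<in> X \<Longrightarrow> M x x = 1"
    and M_row: "x \<in> X \<Longrightarrow> (\<Sum>y\<in>X. M x y) = k"
    and M_sq: "x \<in> X \<Longrightarrow> y \<in> X \<Longrightarrow>
      (\<Sum>z\<in>X. M x z * M z y) = (a + b) * M x y - a * b * of_bool (x = y) + c"
    and distinct_ev: "a \<noteq> b" "a \<noteq> k" "b \<noteq> k"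
begin

definition N where "N = real (card X)"

lemma N_pos: "N > 0"
  using finite_X nonempty_X by (simp add: N_def card_gt_0_iff)

lemma M_col: "y \<in> X \<Longrightarrow> (\<Sum>x\<in>X. M x y) = k"
  using M_row[of y] M_sym[of y] by simp

lemma valency_eq: "c * N = (k - a) * (k - b)"
proof -
  obtain x where x: "x \<in> X"
    using nonempty_X by blast
  have "k * k = (\<Sum>z\<in>X. M x z * k)"
    using M_row[OF x] by (simp flip: sum_distrib_right)
  also have "\<dots> = (\<Sum>z\<in>X. \<Sum>y\<in>X. M x z * M z y)"
    by (simp add: M_row flip: sum_distrib_left)
  also have "\<dots> = (\<Sum>y\<in>X. (a + b) * M x y - a * b * of_bool (x = y) + c)"
    by (subst sum.swap) (simp add: M_sq x)
  also have "\<dots> = (a + b) * k - a * b + c * N"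
    using x finite_X M_row[OF x]
    by (simp add: sum.distrib sum_subtractf N_def flip: sum_distrib_left)
  
  finally show ?thesis
    by (simp add: algebra_simps)
qed

lemma diag_sq_eq: "k = a + b - a * b + c"
proof -
  obtain x where x: "x \<in> X"
    using nonempty_X by blast
  have "k = (\<Sum>z\<in>X. M x z * M z x)"
    using M_01[OF x] M_sym[OF x] unfolding M_row[OF x, symmetric] by (intro sum.cong) fastforce+
  then show ?thesis
    using M_sq[OF x x] M_diag[OF x] by simp
qed

definition comb :: "real \<Rightarrow> real \<Rightarrow> real \<Rightarrow> 'p \<Rightarrow> 'p \<Rightarrow> real" where
  "comb \<alpha> \<beta> \<gamma> x y = \<alpha> * of_bool (x = y) + \<beta> * M x y + \<gamma>"

lemma comb_sym: "x \<in> X \<Longrightarrow> y \<in> X \<Longrightarrow> comb \<alpha> \<beta> \<gamma> x y = comb \<alpha> \<beta> \<gamma> y x"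
  by (auto simp: comb_def M_sym[of x y])

lemma comb_mult:
  assumes x: "x \<in> X" and y: "y \<in> X"
  shows "(\<Sum>z\<in>X. comb \<alpha> \<beta> \<gamma> x z * comb \<alpha>' \<beta>' \<gamma>' z y) =
    comb (\<alpha> * \<alpha>' - a * b * \<beta> * \<beta>') (\<alpha> * \<beta>' + \<beta> * \<alpha>' + (a + b) * \<beta> * \<beta>')
      (\<alpha> * \<gamma>' + \<gamma> * \<alpha>' + \<beta> * \<gamma>' * k + \<gamma> * \<beta>' * k + \<gamma> * \<gamma>' * N + \<beta> * \<beta>' * c) x y"
proof -
  have eq: "comb \<alpha> \<beta> \<gamma> x z * comb \<alpha>' \<beta>' \<gamma>' z y =
      (if z = x then \<alpha> * comb \<alpha>' \<beta>' \<gamma>' x y else 0) +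
      (if z = y then \<alpha>' * (\<beta> * M x y + \<gamma>) else 0) +
      \<beta> * \<beta>' * (M x z * M z y) + \<beta> * \<gamma>' * M x z + \<gamma> * \<beta>' * M z y + \<gamma> * \<gamma>'" for z
    by (auto simp: comb_def algebra_simps)
  show ?thesis
    unfolding eq using x y finite_X
    by (simp add: sum.distrib M_sq M_row M_col flip: sum_distrib_left)
       (simp add: comb_def N_def algebra_simps)
qed

text \<open>\<open>spectral g0 g1 g2\<close> is the element of the algebra spanned by \<open>I\<close>, \<open>M\<close>, \<open>J\<close> that acts as
  \<open>g0\<close>, \<open>g1\<close>, \<open>g2\<close> on the eigenspaces of \<open>M\<close> for \<open>k\<close>, \<open>a\<close>, \<open>b\<close>.\<close>

definition spectral :: "real \<Rightarrow> real \<Rightarrow> real \<Rightarrow> 'p \<Rightarrow> 'p \<Rightarrow> real" where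
  "spectral g0 g1 g2 =
    (let \<beta> = (g1 - g2) / (a - b); \<alpha> = g1 - \<beta> * a in comb \<alpha> \<beta> ((g0 - \<alpha> - \<beta> * k) / N))"

lemma comb_eq_spectral:
  "comb \<alpha> \<beta> \<gamma> = spectral (\<alpha> + \<beta> * k + \<gamma> * N) (\<alpha> + \<beta> * a) (\<alpha> + \<beta> * b)"
proof -
  have "(\<alpha> + \<beta> * a - (\<alpha> + \<beta> * b)) / (a - b) = \<beta>"
    using distinct_ev by (simp add: field_simps)
  then show ?thesis
    using N_pos by (simp add: spectral_def Let_def)
qed

lemma spectral_eq_comb:
  obtains \<alpha> \<beta> \<gamma> where "spectral g0 g1 g2 = comb \<alpha> \<beta> \<gamma>"
    and "g0 = \<alpha> + \<beta> * k + \<gamma> * N" "g1 = \<alpha> + \<beta> * a" "g2 = \<alpha> + \<beta> * b"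
proof -
  define \<beta> where "\<beta> = (g1 - g2) / (a - b)"
  define \<alpha> where "\<alpha> = g1 - \<beta> * a"
  have "\<beta> * (a - b) = g1 - g2"
    using distinct_ev by (simp add: \<beta>_def)
  then have "g2 = \<alpha> + \<beta> * b"
    by (simp add: \<alpha>_def algebra_simps)
  then show ?thesis
    using N_pos by (intro that[of \<alpha> \<beta> "(g0 - \<alpha> - \<beta> * k) / N"])
      (simp_all add: spectral_def Let_def \<alpha>_def \<beta>_def)
qed

lemma spectral_sym: "x \<in> X \<Longrightarrow> y \<in> X \<Longrightarrow> spectral g0 g1 g2 x y = spectral g0 g1 g2 y x"
  by (simp add: spectral_def Let_def comb_sym[of x y])

lemma spectral_mult:
  assumes "x \<in> X" "y \<in> X"
  shows "(\<Sum>z\<in>X. spectral g0 g1 g2 x z * spectral h0 h1 h2 z y) =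
    spectral (g0 * h0) (g1 * h1) (g2 * h2) x y"
proof -
  obtain \<alpha> \<beta> \<gamma> where g: "spectral g0 g1 g2 = comb \<alpha> \<beta> \<gamma>"
    "g0 = \<alpha> + \<beta> * k + \<gamma> * N" "g1 = \<alpha> + \<beta> * a" "g2 = \<alpha> + \<beta> * b"
    by (rule spectral_eq_comb)
  obtain \<alpha>' \<beta>' \<gamma>' where h: "spectral h0 h1 h2 = comb \<alpha>' \<beta>' \<gamma>'"
    "h0 = \<alpha>' + \<beta>' * k + \<gamma>' * N" "h1 = \<alpha>' + \<beta>' * a" "h2 = \<alpha>' + \<beta>' * b"
    by (rule spectral_eq_comb)
  have "(\<alpha> + \<beta> * k + \<gamma> * N) * (\<alpha>' + \<beta>' * k + \<gamma>' * N) - (\<alpha> * \<alpha>' - a * b * \<beta> * \<beta>' + (\<alpha> * \<beta>' + \<beta> * \<alpha>' + (a + b) * \<beta> * \<beta>') * k +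
      (\<alpha> * \<gamma>' + \<gamma> * \<alpha>' + \<beta> * \<gamma>' * k + \<gamma> * \<beta>' * k + \<gamma> * \<gamma>' * N + \<beta> * \<beta>' * c) * N) =
      \<beta> * \<beta>' * ((k - a) * (k - b) - c * N)"
    by (simp add: algebra_simps)
  then have "\<alpha> * \<alpha>' - a * b * \<beta> * \<beta>' + (\<alpha> * \<beta>' + \<beta> * \<alpha>' + (a + b) * \<beta> * \<beta>') * k +
      (\<alpha> * \<gamma>' + \<gamma> * \<alpha>' + \<beta> * \<gamma>' * k + \<gamma> * \<beta>' * k + \<gamma> * \<gamma>' * N + \<beta> * \<beta>' * c) * N = g0 * h0"
    using valency_eq by (simp add: g h)
  moreover have "\<alpha> * \<alpha>' - a * b * \<beta> * \<beta>' + (\<alpha> * \<beta>' + \<beta> * \<alpha>' + (a + b) * \<beta> * \<beta>') * a = g1 * h1"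
    by (simp add: g h algebra_simps)
  moreover have "\<alpha> * \<alpha>' - a * b * \<beta> * \<beta>' + (\<alpha> * \<beta>' + \<beta> * \<alpha>' + (a + b) * \<beta> * \<beta>') * b = g2 * h2"
    by (simp add: g h algebra_simps)
  ultimately show ?thesis
    unfolding g(1) h(1) comb_mult[OF assms] by (subst comb_eq_spectral) presburger
qed

lemma spectral_trace:
  "(\<Sum>x\<in>X. spectral 1 1 1 x x) = N"
  "(\<Sum>x\<in>X. spectral 1 1 0 x x) = 1 + (N * (1 - b) - (k - b)) / (a - b)"
proof -
  show "(\<Sum>x\<in>X. spectral 1 1 1 x x) = N"
    by (simp add: spectral_def comb_def N_def)
  define \<beta> where "\<beta> = 1 / (a - b)"
  have \<beta>: "\<beta> * (a - b) = 1"
    using distinct_ev by (simp add: \<beta>_def)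
  have "(\<Sum>x\<in>X. spectral 1 1 0 x x) = N * (1 - \<beta> * a + \<beta> + (1 - (1 - \<beta> * a) - \<beta> * k) / N)"
    using M_diag by (simp add: spectral_def comb_def Let_def \<beta>_def N_def)
  also have "\<dots> = N * (1 - \<beta> * a + \<beta>) + (\<beta> * a - \<beta> * k)"
    using N_pos by (simp add: distrib_left)
  also have "\<dots> = \<beta> * (a - b) + \<beta> * (N * (1 - b) - (k - b)) + N * (1 - \<beta> * (a - b))"
    by (simp add: algebra_simps)
  also have "\<dots> = 1 + (N * (1 - b) - (k - b)) / (a - b)"
    unfolding \<beta> by (simp add: \<beta>_def)
  finally show "(\<Sum>x\<in>X. spectral 1 1 0 x x) = 1 + (N * (1 - b) - (k - b)) / (a - b)" .
qed

text \<open>If \<open>p\<close> is the pseudo-inverse of \<open>I I\<^sup>T\<close>, then \<open>I\<^sup>T p I\<close> is a symmetric idempotent indexed by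
  \<open>D\<close>, so its diagonal entries are at most 1. Because \<open>0 / 0 = 0\<close>, the trace on the left counts
  exactly the nonzero eigenvalues.\<close>

lemma card_ge_spectral_trace:
  fixes D :: "'d set" and I :: "'p \<Rightarrow> 'd \<Rightarrow> real"
  assumes "finite D"
    and gram: "\<And>x y. x \<in> X \<Longrightarrow> y \<in> X \<Longrightarrow> (\<Sum>U\<in>D. I x U * I y U) = spectral g0 g1 g2 x y"
  shows "(\<Sum>x\<in>X. spectral (g0 / g0) (g1 / g1) (g2 / g2) x x) \<le> card D"
proof -
  define p where "p = spectral (inverse g0) (inverse g1) (inverse g2)"
  define T where "T U y = (\<Sum>x\<in>X. I x U * p x y)" for U y
  define E where "E U V = (\<Sum>y\<in>X. T U y * I y V)" for U V
  have p_sym: "p x y = p y x" if "x \<in> X" "y \<in> X" for x y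
    using that by (simp add: p_def spectral_sym)
  have E_expand: "E U V = (\<Sum>x\<in>X. \<Sum>y\<in>X. I x U * p x y * I y V)" for U V
    unfolding E_def T_def by (subst sum.swap) (simp add: sum_distrib_right)
  have E_sym: "E U V = E V U" for U V
    unfolding E_expand by (subst sum.swap, intro sum.cong refl) (auto simp: p_sym)
  have left: "(\<Sum>x\<in>X. (\<Sum>U\<in>D. I z U * I x U) * p x y) = spectral (g0 / g0) (g1 / g1) (g2 / g2) z y"
    if "z \<in> X" "y \<in> X" for z y
    using that by (simp add: gram p_def spectral_mult divide_inverse)
  have EE: "(\<Sum>V\<in>D. E U V * E V W) = E U W" for U W
  proof -
    have "(\<Sum>V\<in>D. E U V * E V W) = (\<Sum>V\<in>D. \<Sum>y\<in>X. \<Sum>z\<in>X. (T U y * I y V) * (T W z * I z V))"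
      unfolding E_sym[of _ W] by (simp add: E_def sum_product)
    also have "\<dots> = (\<Sum>y\<in>X. \<Sum>z\<in>X. \<Sum>V\<in>D. (T U y * I y V) * (T W z * I z V))"
      by (subst sum.swap, rule sum.cong[OF refl], rule sum.swap)
    also have "\<dots> = (\<Sum>y\<in>X. T U y * (\<Sum>z\<in>X. (\<Sum>V\<in>D. I y V * I z V) * T W z))"
      by (simp add: sum_distrib_left sum_distrib_right mult_ac)
    also have "\<dots> = (\<Sum>y\<in>X. T U y * (\<Sum>w\<in>X. spectral (g0 / g0) (g1 / g1) (g2 / g2) y w * I w W))"
    proof (rule sum.cong[OF refl])
      fix y assume y: "y \<in> X"
      have "(\<Sum>z\<in>X. (\<Sum>V\<in>D. I y V * I z V) * T W z) =
          (\<Sum>w\<in>X. \<Sum>z\<in>X. ((\<Sum>V\<in>D. I y V * I z V) * p z w) * I w W)"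
        unfolding T_def sum_distrib_left
        by (subst sum.swap, intro sum.cong refl) (simp add: p_sym mult_ac)
      also have "\<dots> = (\<Sum>w\<in>X. spectral (g0 / g0) (g1 / g1) (g2 / g2) y w * I w W)"
        using y left by (simp flip: sum_distrib_right)
      finally show "T U y * (\<Sum>z\<in>X. (\<Sum>V\<in>D. I y V * I z V) * T W z) =
          T U y * (\<Sum>w\<in>X. spectral (g0 / g0) (g1 / g1) (g2 / g2) y w * I w W)"
        by (rule arg_cong)
    qed
    also have "\<dots> = (\<Sum>w\<in>X. (\<Sum>y\<in>X. T U y * spectral (g0 / g0) (g1 / g1) (g2 / g2) y w) * I w W)"
      unfolding sum_distrib_left sum_distrib_right by (subst sum.swap) (simp add: mult_ac)
    also have "\<dots> = (\<Sum>w\<in>X. T U w * I w W)"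
    proof (rule sum.cong[OF refl])
      fix w assume w: "w \<in> X"
      have "(\<Sum>y\<in>X. T U y * spectral (g0 / g0) (g1 / g1) (g2 / g2) y w) =
          (\<Sum>x\<in>X. I x U * (\<Sum>y\<in>X. p x y * spectral (g0 / g0) (g1 / g1) (g2 / g2) y w))"
        unfolding T_def sum_distrib_left sum_distrib_right by (subst sum.swap) (simp add: mult_ac)
      also have "\<dots> = T U w"
        using w by (simp add: p_def T_def spectral_mult divide_inverse)
      finally show "(\<Sum>y\<in>X. T U y * spectral (g0 / g0) (g1 / g1) (g2 / g2) y w) * I w W = T U w * I w W"
        by simp
    qed
    finally show ?thesis
      by (simp add: E_def)
  qed
  have "E U U \<le> 1" if "U \<in> D" for U
  proof -
    have "E U U * E U U \<le> (\<Sum>V\<in>D. E U V * E U V)"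
      using that assms(1) by (intro member_le_sum) auto
    also have "\<dots> = E U U"
      using EE[of U U] by (simp add: E_sym)
    finally show ?thesis
      using mult_strict_right_mono[of 1 "E U U" "E U U"] by linarith
  qed
  then have "(\<Sum>U\<in>D. E U U) \<le> card D"
    using sum_bounded_above[of D "\<lambda>U. E U U" 1] by simp
  also have "(\<Sum>U\<in>D. E U U) = (\<Sum>y\<in>X. \<Sum>x\<in>X. \<Sum>U\<in>D. I x U * p x y * I y U)"
  proof -
    have "(\<Sum>U\<in>D. E U U) = (\<Sum>x\<in>X. \<Sum>U\<in>D. \<Sum>y\<in>X. I x U * p x y * I y U)"
      unfolding E_expand by (rule sum.swap)
    also have "\<dots> = (\<Sum>x\<in>X. \<Sum>y\<in>X. \<Sum>U\<in>D. I x U * p x y * I y U)"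
      by (rule sum.cong[OF refl], rule sum.swap)
    also have "\<dots> = (\<Sum>y\<in>X. \<Sum>x\<in>X. \<Sum>U\<in>D. I x U * p x y * I y U)"
      by (rule sum.swap)
    finally show ?thesis .
  qed
  also have "\<dots> = (\<Sum>y\<in>X. \<Sum>x\<in>X. (\<Sum>U\<in>D. I y U * I x U) * p x y)"
    by (simp add: sum_distrib_left sum_distrib_right mult_ac)
  also have "\<dots> = (\<Sum>x\<in>X. spectral (g0 / g0) (g1 / g1) (g2 / g2) x x)"
    using left by simp
  finally show ?thesis .
qed

lemma reindex:
  assumes f: "bij_betw f Y X"
  shows "three_eigenvalue_relation Y (\<lambda>i j. M (f i) (f j)) a b c k"
proof
  have mem: "f i \<in> X" if "i \<in> Y" for i
    using f that by (auto simp: bij_betw_def)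
  show "finite Y"
    using f finite_X bij_betw_finite by blast
  show "Y \<noteq> {}"
    using f nonempty_X by (auto simp: bij_betw_def)
  fix x assume x: "x \<in> Y"
  show "M (f x) (f x) = 1"
    using x by (simp add: M_diag mem)
  show "(\<Sum>y\<in>Y. M (f x) (f y)) = k"
    using sum.reindex_bij_betw[OF f, of "M (f x)"] M_row[OF mem[OF x]] by simp
  fix y assume y: "y \<in> Y"
  show "M (f x) (f y) = M (f y) (f x)" "M (f x) (f y) \<in> {0, 1}"
    using M_sym[of "f x" "f y"] M_01[of "f x" "f y"] x y mem by auto
  have "f x = f y \<longleftrightarrow> x = y"
    using f x y by (auto simp: bij_betw_def inj_on_def)
  then show "(\<Sum>z\<in>Y. M (f x) (f z) * M (f z) (f y)) =
      (a + b) * M (f x) (f y) - a * b * of_bool (x = y) + c"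
    using sum.reindex_bij_betw[OF f, of "\<lambda>z. M (f x) z * M z (f y)"]
      M_sq[OF mem[OF x] mem[OF y]] by simp
qed (use distinct_ev in auto)

end

lemma (in three_eigenvalue_relation) complex_eigenvalue:
  fixes w :: "'p \<Rightarrow> complex"
  assumes ev: "\<And>x. x \<in> X \<Longrightarrow> (\<Sum>y\<in>X. M x y * w y) = \<mu> * w x"
    and "x \<in> X" "w x \<noteq> 0"
  shows "\<mu> \<in> complex_of_real ` {a, b, k}"
proof (cases "\<mu> = k")
  case False
  have "\<mu> * (\<Sum>x\<in>X. w x) = (\<Sum>x\<in>X. \<Sum>y\<in>X. M x y * w y)"
    using ev by (simp add: sum_distrib_left)
  also have "\<dots> = (\<Sum>y\<in>X. of_real (\<Sum>x\<in>X. M x y) * w y)"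
    by (subst sum.swap) (simp add: sum_distrib_right)
  also have "\<dots> = k * (\<Sum>x\<in>X. w x)"
    by (simp add: M_col sum_distrib_left)
  finally have S: "(\<Sum>x\<in>X. w x) = 0"
    using False by simp
  have "\<mu> * \<mu> * w x = (\<Sum>z\<in>X. M x z * (\<mu> * w z))"
    using ev[OF \<open>x \<in> X\<close>] by (simp add: mult_ac flip: sum_distrib_left)
  also have "\<dots> = (\<Sum>z\<in>X. \<Sum>y\<in>X. M x z * M z y * w y)"
    by (simp add: sum_distrib_left mult_ac flip: ev)
  also have "\<dots> = (\<Sum>y\<in>X. of_real (\<Sum>z\<in>X. M x z * M z y) * w y)"
    by (subst sum.swap) (simp add: sum_distrib_right)
  also have "\<dots> = (\<Sum>y\<in>X. (a + b) * (M x y * w y) + (if y = x then - a * b * w x else 0) + c * w y)"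
    by (intro sum.cong refl, subst M_sq[OF \<open>x \<in> X\<close>]) (auto simp: algebra_simps)
  also have "\<dots> = (a + b) * \<mu> * w x - a * b * w x"
    using \<open>x \<in> X\<close> finite_X S ev by (simp add: sum.distrib flip: sum_distrib_left)
  finally have "(\<mu> - a) * (\<mu> - b) * w x = 0"
    by (simp add: algebra_simps)
  then show ?thesis
    using assms(3) by auto
qed auto

lemma order_char_poly_shift:
  assumes "three_eigenvalue_relation {..<n} M a b c k"
  defines "A \<equiv> mat n n (\<lambda>(i, j). M i j - of_bool (i = j))"
  shows "real (Polynomial.order (a - 1) (char_poly A)) = (n * (1 - b) - (k - b)) / (a - b)"
proof -
  interpret three_eigenvalue_relation "{..<n}" M a b c k
    by fact
  have A: "A \<in> carrier_mat n n"
    by (simp add: A_def)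
  have "e \<in> complex_of_real ` {a - 1, b - 1, k - 1}" if ev: "eigenvalue (map_mat complex_of_real A) e" for e
  proof -
    obtain v where v: "v \<in> carrier_vec n" "v \<noteq> 0\<^sub>v n" "map_mat complex_of_real A *\<^sub>v v = e \<cdot>\<^sub>v v"
      using ev A by (auto simp: eigenvalue_def eigenvector_def)
    have "(\<Sum>j<n. M i j * v $ j) = (e + 1) * v $ i" if i: "i < n" for i
    proof -
      have "e * v $ i = (map_mat complex_of_real A *\<^sub>v v) $ i"
        using v i by simp
      also have "\<dots> = (\<Sum>j<n. (M i j - of_bool (i = j)) * v $ j)"
        using v(1) i A by (simp add: scalar_prod_def A_def atLeast0LessThan)
      also have "\<dots> = (\<Sum>j<n. M i j * v $ j + (if j = i then - v $ i else 0))"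
        by (intro sum.cong refl) (auto simp: algebra_simps)
      also have "\<dots> = (\<Sum>j<n. M i j * v $ j) - v $ i"
        using i by (simp add: sum.distrib)
      finally show ?thesis
        by (simp add: algebra_simps)
    qed
    moreover obtain i where "i < n" "v $ i \<noteq> 0"
      using v(1,2) by (metis carrier_vecD eq_vecI index_zero_vec)
    ultimately have "e + 1 \<in> complex_of_real ` {a, b, k}"
      by (intro complex_eigenvalue[of "\<lambda>i. v $ i" _ i]) auto
    then show ?thesis
      by (auto simp: eq_diff_eq)
  qed
  from char_poly_splits_if_eigenvalues_real[OF A this] obtain es where
    es: "char_poly A = (\<Prod>e\<leftarrow>es. [:- e, 1:])" "set es \<subseteq> {a - 1, b - 1, k - 1}"
    by blast
  note tr = split_char_poly_traces[OF A es(1)]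
  have "sum_list es = 0"
    using tr(1) M_diag by (simp add: A_def)
  have "(A * A) $$ (i, i) = k - 1" if i: "i < n" for i
  proof -
    have "(A * A) $$ (i, i) = (\<Sum>j<n. (M i j - of_bool (i = j)) * (M j i - of_bool (j = i)))"
      using i by (simp add: scalar_prod_def A_def atLeast0LessThan)
    also have "\<dots> = (\<Sum>j<n. M i j + (if j = i then - 1 else 0))"
    proof (rule sum.cong[OF refl])
      fix j assume "j \<in> {..<n}"
      then have "M i j \<in> {0, 1}" "M j i = M i j" "M i i = 1"
        using i M_diag[of i] M_01[of i j] M_sym[of i j] by auto
      then show "(M i j - of_bool (i = j)) * (M j i - of_bool (j = i)) = M i j + (if j = i then - 1 else 0)"
        by (auto simp: of_bool_def)
    qed
    also have "\<dots> = k - 1"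
      using i M_row[of i] by (simp add: sum.distrib)
    finally show ?thesis .
  qed
  then have "(\<Sum>e\<leftarrow>es. e\<^sup>2) = n * (k - 1)"
    using tr(2) by simp
  have "(a - k) * (a - b) * count_list es (a - 1) = (\<Sum>e\<leftarrow>es. (e - (k - 1)) * (e - (b - 1)))"
    using es(2) by (induction es) (auto simp: algebra_simps)
  also have "\<dots> = (\<Sum>e\<leftarrow>es. e\<^sup>2) - ((k - 1) + (b - 1)) * sum_list es + (k - 1) * (b - 1) * length es"
    by (induction es) (auto simp: algebra_simps power2_eq_square)
  also have "\<dots> = n * (k - 1) * b"
    using \<open>sum_list es = 0\<close> \<open>(\<Sum>e\<leftarrow>es. e\<^sup>2) = n * (k - 1)\<close> tr(3) by (simp add: algebra_simps)
  also have "\<dots> = (a - k) * (n * (1 - b) - (k - b))"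
  proof -
    have "c * n = (k - a) * (k - b)" "c = k - a - b + a * b"
      using valency_eq diag_sq_eq by (simp_all add: N_def)
    then have "(k - a - b + a * b) * n = (k - a) * (k - b)"
      by simp
    then show ?thesis
      by (simp add: algebra_simps)
  qed
  finally have "(a - b) * count_list es (a - 1) = n * (1 - b) - (k - b)"
    using distinct_ev by (simp add: mult.assoc)
  then have "count_list es (a - 1) = (n * (1 - b) - (k - b)) / (a - b)"
    using distinct_ev by (simp add: field_simps)
  then show ?thesis
    by (simp add: es(1) order_prod_list_linear)
qed

section \<open>Counting singular vectors\<close>

context finite_field_space
begin

lemma card_span_independent:
  assumes "finite S" "independent S"
  shows "finite (span S) \<and> card (span S) = CARD('a) ^ card S"
  using assms
proof (induction S)
  case (insert b S)
  have b: "b \<notin> span S" and S: "independent S"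
    using insert.prems insert.hyps by (auto simp: independent_insert)
  have IH: "finite (span S)" "card (span S) = CARD('a) ^ card S"
    using insert.IH S by auto
  have "span (insert b S) = (\<lambda>(c, x). scale c b + x) ` (UNIV \<times> span S)"
  proof (intro equalityI subsetI)
    fix x assume "x \<in> span (insert b S)"
    then obtain c where "x - scale c b \<in> span S"
      by (auto simp: span_insert)
    then show "x \<in> (\<lambda>(c, x). scale c b + x) ` (UNIV \<times> span S)"
      by (intro image_eqI[of _ _ "(c, x - scale c b)"]) auto
  next
    fix y assume "y \<in> (\<lambda>(c, x). scale c b + x) ` (UNIV \<times> span S)"
    then obtain c x where "x \<in> span S" "y = scale c b + x"
      by auto
    then show "y \<in> span (insert b S)"
      unfolding span_insert by (intro CollectI exI[of _ c]) auto
  qed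
  moreover have "inj_on (\<lambda>(c, x). scale c b + x) (UNIV \<times> span S)"
  proof (clarsimp simp: inj_on_def, safe)
    fix c d x y assume *: "x \<in> span S" "y \<in> span S" "scale c b + x = scale d b + y"
    have "scale (c - d) b = y - x"
      using *(3) by (simp add: scale_left_diff_distrib algebra_simps)
    then have "scale (c - d) b \<in> span S"
      using * by (simp add: span_diff)
    then show "c = d"
      using b span_scale[of "scale (c - d) b" S "inverse (c - d)"] by (cases "c = d") auto
    with * show "x = y"
      by simp
  qed
  ultimately show ?case
    using IH insert.hyps by (simp add: card_image card_cartesian_product)
qed auto

lemma span_subset_iff: "subspace U \<Longrightarrow> span S \<subseteq> U \<longleftrightarrow> S \<subseteq> U"
  using span_minimal span_superset by blast

lemma finite_vectors: "finite (A :: 'v set)"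
  using card_span_independent[OF finite_Basis independent_Basis] span_Basis
  by (metis finite_subset subset_UNIV)

lemma finite_subspaces: "finite (\<U> :: 'v set set)"
  using finite_vectors[of UNIV] by (metis finite_Pow_iff finite_subset Pow_UNIV subset_UNIV)

lemma card_subspace:
  assumes "subspace U"
  shows "card U = CARD('a) ^ dim U"
proof -
  obtain S where S: "S \<subseteq> U" "independent S" "U \<subseteq> span S" "card S = dim U"
    using basis_exists by blast
  moreover have "span S = U"
    using S assms by (metis span_minimal subset_antisym)
  ultimately show ?thesis
    using card_span_independent[of S] finite_vectors by simp
qed

lemma subspace_eq_if_dim_eq:
  assumes "subspace U" "subspace W" "U \<subseteq> W" "dim U = dim W"
  shows "U = W"
  using assms card_subspace by (intro card_subset_eq) (auto simp: finite_vectors)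

lemma dim_span_insert:
  assumes "subspace S" "x \<notin> S"
  shows "dim (span (insert x S)) = Suc (dim S)"
proof -
  obtain T where T: "T \<subseteq> S" "independent T" "S \<subseteq> span T" "card T = dim S"
    using basis_exists by blast
  have S: "span T = S"
    using T assms by (metis span_minimal subset_antisym)
  then have ind: "independent (insert x T)"
    using T assms by (auto simp: independent_insert)
  have "span (insert x S) = span (insert x T)"
    using assms(1) S by (simp add: span_insert flip: span_eq_iff)
  moreover have "x \<notin> T"
    using assms T by auto
  ultimately show ?thesis
    using dim_span_eq_card_independent[OF ind] T(4) by (simp add: finite_vectors)
qed

lemma line_eq_span:
  assumes "subspace P" "dim P = 1" "x \<in> P" "x \<noteq> 0"
  shows "P = span {x}"
proof -
  have "dim (span {x}) = 1"
    using dim_span_eq_card_independent[of "{x}"] assms(4) by simp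
  then show ?thesis
    using assms by (intro subspace_eq_if_dim_eq[symmetric]) (auto simp: span_minimal)
qed

lemma card_functional_fibre:
  fixes f :: "'v \<Rightarrow> 'a"
  assumes X: "subspace X" and add: "\<And>x y. f (x + y) = f x + f y"
    and scale: "\<And>c x. f (scale c x) = c * f x"
    and x0: "x0 \<in> X" "f x0 \<noteq> 0"
  shows "CARD('a) * card {x \<in> X. f x = c} = card X"
proof -
  have diff: "f (x - y) = f x - f y" for x y
    using add[of "x - y" y] by simp
  have eq: "card {x \<in> X. f x = d} = card {x \<in> X. f x = c}" for d
  proof -
    define z where "z = scale ((c - d) / f x0) x0"
    have "z \<in> X" "f z = c - d"
      using X x0 by (simp_all add: z_def scale subspace_scale)
    then show ?thesis
      using X by (intro bij_betw_same_card[of "\<lambda>x. x + z"] bij_betwI[where g = "\<lambda>x. x - z"])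
        (auto simp: add diff subspace_add subspace_diff)
  qed
  have "card X = (\<Sum>d\<in>UNIV. card {x \<in> X. f x = d})"
    using sum_multicount_gen[of X UNIV "\<lambda>x d. f x = d"] finite_vectors by simp
  also have "\<dots> = (\<Sum>d\<in>(UNIV :: 'a set). card {x \<in> X. f x = c})"
    by (rule sum.cong[OF refl], rule eq)
  finally show ?thesis
    by simp
qed

end

text \<open>A common frame for the three kinds of forms. The constant \<open>\<kappa>\<close> is \<open>q\<close> for alternating forms,
  \<open>1\<close> for quadratic forms and \<open>sqrt q\<close> for Hermitian forms.\<close>

locale polar_form = finite_field_space scale Basis
  for scale :: "'a::{field,finite} \<Rightarrow> 'v::ab_group_add \<Rightarrow> 'v" and Basis :: "'v set" +
  fixes B :: "'v \<Rightarrow> 'v \<Rightarrow> 'a" and sing :: "'v \<Rightarrow> bool" and q \<kappa> :: nat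
  assumes q_eq: "q = CARD('a)"
    and B_add: "B (x + y) z = B x z + B y z"
    and B_scale: "B (scale c x) z = c * B x z"
    and B_sym: "B x y = 0 \<Longrightarrow> B y x = 0"
    and sing_0: "sing 0"
    and sing_scale: "sing x \<Longrightarrow> sing (scale c x)"
    and sing_add: "sing x \<Longrightarrow> sing y \<Longrightarrow> B x y = 0 \<Longrightarrow> sing (x + y)"
    and sing_self: "sing x \<Longrightarrow> B x x = 0"
    and sing_radical: "sing x \<Longrightarrow> (\<And>y. B x y = 0) \<Longrightarrow> x = 0"
    and card_sing_coset:
      "subspace S \<Longrightarrow> (\<And>x y. x \<in> S \<Longrightarrow> y \<in> S \<Longrightarrow> sing x \<and> B x y = 0) \<Longrightarrow> s \<in> S \<Longrightarrow> B s y \<noteq> 0 \<Longrightarrow>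
        q * card {s \<in> S. sing (y + s)} = \<kappa> * card S"
begin

definition tsing :: "'v set \<Rightarrow> bool" where
  "tsing U \<longleftrightarrow> subspace U \<and> (\<forall>x\<in>U. sing x \<and> (\<forall>y\<in>U. B x y = 0))"

definition perp :: "'v set \<Rightarrow> 'v set" where
  "perp S = {y. \<forall>s\<in>S. B y s = 0}"

definition num_sing_perp :: "'v set \<Rightarrow> nat" where
  "num_sing_perp S = card {x \<in> perp S. sing x}"

lemma q_ge_2: "q \<ge> 2"
proof -
  have "card {0, 1 :: 'a} \<le> q"
    unfolding q_eq by (intro card_mono) auto
  then show ?thesis
    by simp
qed

lemma B_zero [simp]: "B 0 z = 0"
  using B_scale[of 0 0 z] by simp

lemma B_zero_right [simp]: "B z 0 = 0"
  using B_sym B_zero by blast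

lemma B_sym_iff: "B x y = 0 \<longleftrightarrow> B y x = 0"
  using B_sym by blast

lemma subspace_perp: "subspace (perp S)"
  by (auto simp: perp_def subspace_def B_add B_scale)

lemma perp_span: "perp (span S) = perp S"
proof -
  have "B y s = 0" if "y \<in> perp S" "s \<in> span S" for y s
  proof -
    have "subspace {s. B s y = 0}"
      by (auto simp: subspace_def B_add B_scale)
    moreover have "S \<subseteq> {s. B s y = 0}"
      using that by (auto simp: perp_def B_sym_iff[of _ y])
    ultimately have "s \<in> {s. B s y = 0}"
      using that span_minimal by blast
    then show ?thesis
      using B_sym by blast
  qed
  then show ?thesis
    by (auto simp: perp_def intro: span_base)
qed

lemma tsing_subset_perp: "tsing S \<Longrightarrow> S \<subseteq> perp S"
  by (auto simp: tsing_def perp_def)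

lemma tsing_zero: "tsing {0}"
  by (auto simp: tsing_def sing_0)

lemma tsing_span_insert:
  assumes "tsing S" "x \<in> perp S" "sing x"
  shows "tsing (span (insert x S))"
proof -
  have S: "subspace S" "span S = S"
    using assms by (auto simp: tsing_def span_eq_iff)
  have mem: "\<exists>c s. s \<in> S \<and> y = scale c x + s" if y: "y \<in> span (insert x S)" for y
  proof -
    obtain c where "y - scale c x \<in> S"
      using y S by (auto simp: span_insert)
    then show ?thesis
      by (intro exI[of _ c] exI[of _ "y - scale c x"]) auto
  qed
  have "span (insert x S) \<subseteq> perp (span (insert x S))"
    unfolding perp_span using assms by (intro span_minimal subspace_perp)
      (auto simp: perp_def tsing_def sing_self B_sym_iff[of _ x])
  then have "\<forall>y\<in>span (insert x S). \<forall>z\<in>span (insert x S). B y z = 0"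
    by (auto simp: perp_def)
  moreover have "\<forall>y\<in>span (insert x S). sing y"
  proof
    fix y assume "y \<in> span (insert x S)"
    then obtain c s where "s \<in> S" "y = scale c x + s"
      using mem by blast
    then show "sing y"
      using assms by (auto intro!: sing_add sing_scale simp: B_scale tsing_def perp_def)
  qed
  ultimately show ?thesis
    by (auto simp: tsing_def)
qed

lemma card_kernel:
  assumes "subspace X"
  shows "q * card {x \<in> X. B x y = 0} = (if \<forall>x\<in>X. B x y = 0 then q * card X else card X)"
proof (cases "\<forall>x\<in>X. B x y = 0")
  case True
  then have "{x \<in> X. B x y = 0} = X"
    by blast
  then show ?thesis
    using True by simp
next
  case False
  then obtain x0 where "x0 \<in> X" "B x0 y \<noteq> 0"
    by blast
  then show ?thesis
    using card_functional_fibre[OF assms, of "\<lambda>x. B x y" x0 0] False by (auto simp: B_add B_scale q_eq)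
qed

text \<open>By double counting of the pairs \<open>(x, s)\<close> with \<open>s \<in> S\<close> and \<open>B s x = 0\<close>.\<close>

lemma card_perp:
  assumes "tsing S"
  shows "card (perp S) * card S = CARD('v)"
proof -
  have S: "subspace S" and 0: "0 \<in> S"
    using assms by (auto simp: tsing_def subspace_0)
  have fin: "finite (A :: 'v set)" for A
    by (rule finite_vectors)
  let ?V = "CARD('v)"
  have "(\<Sum>x\<in>UNIV. q * card {s \<in> S. B s x = 0}) =
      (\<Sum>x\<in>UNIV. if x \<in> perp S then q * card S else card S)"
    unfolding card_kernel[OF S] by (intro sum.cong refl) (auto simp: perp_def B_sym_iff)
  also have "\<dots> = q * card (perp S) * card S + card (- perp S) * card S"
    using fin by (simp add: sum.If_cases)
  finally have 1: "(\<Sum>x\<in>UNIV. q * card {s \<in> S. B s x = 0}) = \<dots>" .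
  have "(\<Sum>x\<in>UNIV. q * card {s \<in> S. B s x = 0}) = q * (\<Sum>s\<in>S. card {x. B s x = 0})"
    unfolding sum_distrib_left[symmetric]
    using sum_multicount_gen[of UNIV S "\<lambda>x s. B s x = 0"] fin by simp
  also have "\<dots> = (\<Sum>s\<in>S. if s = 0 then q * ?V else ?V)"
    unfolding sum_distrib_left
  proof (intro sum.cong refl)
    fix s assume s: "s \<in> S"
    have "(\<forall>x\<in>UNIV. B x s = 0) \<longleftrightarrow> s = 0"
      using sing_radical[of s] s assms by (auto simp: tsing_def B_sym_iff)
    then show "q * card {x. B s x = 0} = (if s = 0 then q * ?V else ?V)"
      using card_kernel[OF subspace_UNIV, of s] by (simp add: B_sym_iff[of s])
  qed
  also have "\<dots> = q * ?V + (card S - 1) * ?V"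
  proof -
    have "(\<Sum>s\<in>S - {0}. if s = 0 then q * ?V else ?V) = (\<Sum>s\<in>S - {0}. ?V)"
      by (rule sum.cong) auto
    then show ?thesis
      using 0 fin by (simp add: sum.remove[OF _ 0])
  qed
  finally have "q * card (perp S) * card S + card (- perp S) * card S = q * ?V + (card S - 1) * ?V"
    using 1 by simp
  moreover have "?V = card (perp S) + card (- perp S)"
    using card_Un_disjoint[of "perp S" "- perp S"] fin by simp
  moreover have "card S \<ge> 1"
    using 0 fin by (auto simp: Suc_le_eq card_gt_0_iff)
  moreover obtain q' where "q = Suc q'" "q' > 0"
    using q_ge_2 by (cases q) auto
  moreover obtain m where "card S = Suc m"
    using \<open>card S \<ge> 1\<close> by (cases "card S") auto
  ultimately have "q' * (card (perp S) * card S) = q' * ?V"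
    by (simp add: algebra_simps)
  then show ?thesis
    using \<open>q' > 0\<close> by simp
qed

text \<open>A translate \<open>y + S\<close> consists of singular vectors or of nonsingular ones if
  \<open>y \<in> perp S\<close>, and otherwise contains \<open>\<kappa> / q\<close> times its cardinality many.\<close>

lemma card_sing_eq_num_sing_perp:
  assumes "tsing S"
  shows "q * card {x. sing x} = q * num_sing_perp S + \<kappa> * card (- perp S)"
proof -
  have S: "subspace S" and 0: "0 \<in> S"
    using assms by (auto simp: tsing_def subspace_0)
  have fin: "finite (A :: 'v set)" for A
    by (rule finite_vectors)
  have shift: "y + s \<in> perp S \<longleftrightarrow> y \<in> perp S" if "s \<in> S" for y s
    using assms that by (auto simp: perp_def tsing_def B_add)
  have "card {x \<in> - perp S. sing (x + s)} = card {x \<in> - perp S. sing x}" if "s \<in> S" for s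
    by (rule bij_betw_same_card[of "\<lambda>x. x + s"], rule bij_betwI[where g = "\<lambda>x. x + - s"])
       (use shift[OF that] shift[of "- s"] subspace_neg[OF S that] in auto)
  then have "(\<Sum>y\<in>- perp S. card {s \<in> S. sing (y + s)}) = (\<Sum>s\<in>S. card {x \<in> - perp S. sing x})"
    using fin by (intro sum_multicount_gen) auto
  then have "q * (\<Sum>y\<in>- perp S. card {s \<in> S. sing (y + s)}) = card S * (q * card {x \<in> - perp S. sing x})"
    by simp
  moreover have "q * (\<Sum>y\<in>- perp S. card {s \<in> S. sing (y + s)}) = card S * (\<kappa> * card (- perp S))"
  proof -
    have "q * card {s \<in> S. sing (y + s)} = \<kappa> * card S" if y: "y \<in> - perp S" for y
    proof -
      obtain s where "s \<in> S" "B s y \<noteq> 0"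
        using y by (auto simp: perp_def B_sym_iff)
      then show ?thesis
        using card_sing_coset[OF S, of s y] assms by (auto simp: tsing_def)
    qed
    then show ?thesis
      unfolding sum_distrib_left by simp
  qed
  moreover have "card S > 0"
    using 0 fin by (auto simp: card_gt_0_iff)
  ultimately have "q * card {x \<in> - perp S. sing x} = \<kappa> * card (- perp S)"
    by simp
  moreover have "card {x. sing x} = num_sing_perp S + card {x \<in> - perp S. sing x}"
    unfolding num_sing_perp_def using fin
    by (subst card_Un_disjoint[symmetric]) (auto intro: arg_cong[of _ _ card])
  ultimately show ?thesis
    by (simp add: distrib_left)
qed

lemma num_sing_perp_maximal:
  assumes "tsing U" and max: "\<And>W. tsing W \<Longrightarrow> dim W \<le> dim U"
  shows "num_sing_perp U = q ^ dim U"
proof -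
  have U: "subspace U"
    using assms by (auto simp: tsing_def)
  have "x \<in> U" if "x \<in> perp U" "sing x" for x
    using max[OF tsing_span_insert[OF assms(1) that]] dim_span_insert[OF U, of x] by force
  then have "{x \<in> perp U. sing x} = U"
    using assms tsing_subset_perp[OF assms(1)] by (auto simp: tsing_def)
  then show ?thesis
    by (simp add: num_sing_perp_def card_subspace[OF U] q_eq)
qed

text \<open>The hyperbolic line spanned by \<open>u\<close> and \<open>v\<close> splits off: \<open>perp {u}\<close> is the direct sum of
  the line through \<open>u\<close> and \<open>perp {u, v}\<close>.\<close>

lemma num_sing_perp_hyperbolic:
  assumes "sing u" "B u v \<noteq> 0"
  shows "num_sing_perp {u} = q * num_sing_perp {u, v}"
proof -
  let ?W = "{x \<in> perp {u, v}. sing x}"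
  have "bij_betw (\<lambda>(c, w). scale c u + w) (UNIV \<times> ?W) {x \<in> perp {u}. sing x}"
    unfolding bij_betw_def
  proof
    show "inj_on (\<lambda>(c, w). scale c u + w) (UNIV \<times> ?W)"
    proof (clarsimp simp: inj_on_def)
      fix c d x y
      assume *: "x \<in> perp {u, v}" "y \<in> perp {u, v}" "scale c u + x = scale d u + y"
      have "B x v = 0" "B y v = 0"
        using * by (auto simp: perp_def)
      moreover have "B (scale c u + x) v = B (scale d u + y) v"
        using *(3) by simp
      ultimately have "c = d"
        using assms by (simp only: B_add B_scale) simp
      with * show "c = d \<and> x = y"
        by simp
    qed
    have "\<exists>c w. w \<in> ?W \<and> x = scale c u + w" if x: "x \<in> perp {u}" "sing x" for x
    proof -
      let ?c = "B x v / B u v"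
      have w: "B (x + scale (- ?c) u) v = 0" "B (x + scale (- ?c) u) u = 0"
        using x assms by (simp_all only: B_add B_scale) (simp_all add: perp_def sing_self)
      moreover have "sing (x + scale (- ?c) u)"
      proof (intro sing_add sing_scale x assms)
        have "B u x = 0"
          using x B_sym[of x u] by (simp add: perp_def)
        then have "B (scale (- ?c) u) x = 0"
          by (simp only: B_scale) simp
        then show "B x (scale (- ?c) u) = 0"
          by (rule B_sym)
      qed
      ultimately show ?thesis
        by (intro exI[of _ ?c] exI[of _ "x + scale (- ?c) u"]) (simp add: perp_def)
    qed
    moreover have "scale c u + w \<in> perp {u} \<and> sing (scale c u + w)" if w: "w \<in> ?W" for c w
    proof -
      have "B w u = 0" "B u w = 0"
        using w B_sym[of w u] by (auto simp: perp_def)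
      then show ?thesis
        using assms w by (auto simp: perp_def B_add B_scale sing_self intro!: sing_add sing_scale)
    qed
    ultimately show "(\<lambda>(c, w). scale c u + w) ` (UNIV \<times> ?W) = {x \<in> perp {u}. sing x}"
      by force
  qed
  from bij_betw_same_card[OF this] show ?thesis
    by (simp add: num_sing_perp_def card_cartesian_product q_eq)
qed

end

text \<open>The number \<open>e\<close> is \<open>q powr (r + \<epsilon>)\<close>.\<close>

locale polar_form_of_rank = polar_form scale Basis B sing q \<kappa>
  for scale :: "'a::{field,finite} \<Rightarrow> 'v::ab_group_add \<Rightarrow> 'v" and Basis :: "'v set"
    and B sing q \<kappa> +
  fixes r :: nat and e :: real
  assumes max_tsing: "\<exists>U. tsing U \<and> dim U = r"
    and dim_tsing: "tsing U \<Longrightarrow> dim U \<le> r"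
    and e_eq: "real \<kappa> * real q ^ dim UNIV = e * real q ^ Suc r"
    and e_pos: "e > 0"
begin

lemma num_sing_perp_eq:
  assumes "tsing S"
  shows "real (num_sing_perp S) = q ^ r + e * q ^ (r - dim S) - e"
proof -
  have q: "real q > 0"
    using q_ge_2 by simp
  have card: "q * card {x. sing x} = q * real (num_sing_perp S) + e * q ^ Suc r - e * q ^ Suc (r - dim S)"
    if S: "tsing S" for S
  proof -
    have V: "real CARD('v) = q ^ dim UNIV"
      using card_subspace[OF subspace_UNIV] by (simp add: q_eq)
    have sub: "subspace S"
      using S by (simp add: tsing_def)
    have "real (card (perp S)) * real (card S) = CARD('v)"
      using card_perp[OF S] by (simp flip: of_nat_mult)
    then have P: "real (card (perp S)) = q ^ dim UNIV / q ^ dim S"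
      using q V card_subspace[OF sub] by (simp add: field_simps q_eq)
    have "card (perp S) \<le> CARD('v)"
      by (intro card_mono finite_vectors) auto
    then have "real (card (- perp S)) = real CARD('v) - card (perp S)"
      unfolding Compl_eq_Diff_UNIV card_Diff_subset[OF finite_vectors subset_UNIV] by (rule of_nat_diff)
    then have C: "real (card (- perp S)) = q ^ dim UNIV - q ^ dim UNIV / q ^ dim S"
      unfolding P V .
    have "real \<kappa> * card (- perp S) = e * q ^ Suc r - e * q ^ Suc r / q ^ dim S"
      unfolding C right_diff_distrib times_divide_eq_right of_nat_power e_eq ..
    also have "e * q ^ Suc r / q ^ dim S = e * q ^ Suc (r - dim S)"
    proof -
      obtain m where "r = dim S + m"
        using dim_tsing[OF S] le_Suc_ex by blast
      then show ?thesis
        using q by (simp add: power_add)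
    qed
    finally have "real \<kappa> * card (- perp S) = e * q ^ Suc r - e * q ^ Suc (r - dim S)" .
    moreover have "real q * card {x. sing x} = q * real (num_sing_perp S) + \<kappa> * real (card (- perp S))"
      using card_sing_eq_num_sing_perp[OF S] by (metis of_nat_add of_nat_mult)
    ultimately show ?thesis
      by simp
  qed
  obtain U where U: "tsing U" "dim U = r"
    using max_tsing by blast
  have "real (num_sing_perp U) = q ^ r"
    using num_sing_perp_maximal[OF U(1)] U(2) dim_tsing by simp
  then have "q * real (num_sing_perp S) - e * q ^ Suc (r - dim S) = q * q ^ r - e * q"
    using card[OF U(1)] card[OF assms] U(2) by simp
  then have "q * real (num_sing_perp S) = q * (q ^ r + e * q ^ (r - dim S) - e)"
    by (simp add: algebra_simps)
  then show ?thesis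
    using q by simp
qed

end

section \<open>The collinearity graph and designs\<close>

context polar_form
begin

lemma tsing_line: "sing x \<Longrightarrow> tsing (span {x})"
  using tsing_span_insert[OF tsing_zero, of x]
  by (simp add: perp_def insert_commute[of x] span_insert_0)

abbreviation points :: "'v set set" where
  "points \<equiv> polar_points (Collect tsing)"

lemma points_iff: "P \<in> points \<longleftrightarrow> tsing P \<and> dim P = 1"
  by (simp add: polar_points_def)

lemma pointE:
  assumes "P \<in> points"
  obtains u where "u \<noteq> 0" "sing u" "P = span {u}" "u \<in> P" "perp P = perp {u}"
proof -
  have P: "subspace P" "dim P = 1"
    using assms by (auto simp: points_iff tsing_def)
  have "\<not> P \<subseteq> {0}"
    using card_mono[of "{0}" P] card_subspace[OF P(1)] P(2) q_ge_2 by (auto simp: q_eq)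
  then obtain u where "u \<in> P" "u \<noteq> 0"
    by blast
  then show ?thesis
    using that[of u] assms line_eq_span[OF P, of u] perp_span[of "{u}"]
    by (auto simp: points_iff tsing_def)
qed

lemma point_of_vector:
  assumes "sing x" "x \<noteq> 0"
  shows "span {x} \<in> points"
  using tsing_line[OF assms(1)] dim_span_eq_card_independent[of "{x}"] assms(2)
  by (simp add: points_iff)

lemma card_points_subset:
  assumes X: "subspace X"
  shows "(real q - 1) * card {P \<in> points. P \<subseteq> X} = real (card {x \<in> X. sing x}) - 1"
proof -
  have fin: "finite (A :: 'v set)" for A
    by (rule finite_vectors)
  let ?X = "{x \<in> X. sing x} - {0}"
  have "(\<Sum>x\<in>?X. card {P \<in> {P \<in> points. P \<subseteq> X}. x \<in> P}) = (q - 1) * card {P \<in> points. P \<subseteq> X}"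
  proof (intro sum_multicount ballI finite_subspaces fin)
    fix P assume P: "P \<in> {P \<in> points. P \<subseteq> X}"
    then have "{x \<in> ?X. x \<in> P} = P - {0}"
      by (auto simp: points_iff tsing_def)
    moreover have "card P = q" "0 \<in> P"
      using P card_subspace[of P] by (auto simp: points_iff tsing_def q_eq subspace_0)
    ultimately show "card {x \<in> ?X. x \<in> P} = q - 1"
      using fin by simp
  qed
  moreover have "card {P \<in> {P \<in> points. P \<subseteq> X}. x \<in> P} = 1" if x: "x \<in> ?X" for x
  proof -
    have "{P \<in> {P \<in> points. P \<subseteq> X}. x \<in> P} = {span {x}}"
      using x X point_of_vector[of x] line_eq_span[of _ x]
      by (auto simp: points_iff tsing_def span_base intro: subsetD[OF span_minimal])
    then show ?thesis
      by simp
  qed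
  ultimately have "card ?X = (q - 1) * card {P \<in> points. P \<subseteq> X}"
    by simp
  moreover have "card {x \<in> X. sing x} = Suc (card ?X)"
    using X sing_0 fin by (subst card.remove[of _ 0]) (auto simp: subspace_0)
  ultimately show ?thesis
    using q_ge_2 by (simp add: of_nat_diff)
qed

lemma subset_perp_sym: "P \<subseteq> perp R \<longleftrightarrow> R \<subseteq> perp P"
  using B_sym by (auto simp: perp_def)

lemma perp_Un: "perp (S \<union> T) = perp S \<inter> perp T"
  by (auto simp: perp_def)

lemma tsing_span_two_points:
  assumes P: "P \<in> points" and R: "R \<in> points" and "P \<noteq> R" "R \<subseteq> perp P"
  shows "tsing (span (P \<union> R))" "dim (span (P \<union> R)) = 2"
proof -
  obtain v where v: "v \<noteq> 0" "sing v" "R = span {v}" "v \<in> R"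
    using R by (rule pointE)
  have P': "tsing P" "subspace P" "dim P = 1"
    using P by (auto simp: points_iff tsing_def)
  have "v \<notin> P"
    using line_eq_span[OF P'(2,3), of v] v assms(3) by auto
  have "span (P \<union> R) = span (insert v P)"
  proof (intro equalityI span_minimal subspace_span)
    show "P \<union> R \<subseteq> span (insert v P)"
      using v(3) span_mono[of "{v}" "insert v P"] by (auto intro: span_base)
    show "insert v P \<subseteq> span (P \<union> R)"
      using v(4) by (auto intro: span_base)
  qed
  then show "tsing (span (P \<union> R))" "dim (span (P \<union> R)) = 2"
    using tsing_span_insert[OF P'(1), of v] dim_span_insert[OF P'(2) \<open>v \<notin> P\<close>] v assms(4) P'(3)
    by auto
qed

lemma collinear_iff:
  assumes "P \<in> points" "R \<in> points"
  shows "collinear (Collect tsing) P R \<longleftrightarrow> P \<noteq> R \<and> R \<subseteq> perp P"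
  using tsing_span_two_points[OF assms] span_superset[of "P \<union> R"]
  by (auto simp: collinear_def tsing_def perp_def)

definition adj :: "'v set \<Rightarrow> 'v set \<Rightarrow> real" where
  "adj P R = of_bool (R \<subseteq> perp P)"

end

context polar_form_of_rank
begin

lemma card_points_subset_perp:
  assumes "tsing S"
  shows "(real q - 1) * card {P \<in> points. P \<subseteq> perp S} = real q ^ r + e * real q ^ (r - dim S) - e - 1"
  using card_points_subset[OF subspace_perp, of S] num_sing_perp_eq[OF assms]
  by (simp add: num_sing_perp_def)

lemma card_points: "(real q - 1) * card points = (real q ^ r - 1) * (e + 1)"
proof -
  have "{P \<in> points. P \<subseteq> perp {0}} = points"
    by (auto simp: perp_def)
  moreover have "dim {0} = 0"
    by (simp add: dim_eq_0)
  ultimately show ?thesis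
    using card_points_subset_perp[OF tsing_zero] by (simp add: algebra_simps)
qed

definition valency :: real where
  "valency = (real q ^ r + e * real q ^ (r - 1) - e - 1) / (real q - 1)"

definition shift_const :: real where
  "shift_const = (real q ^ (r - 1) + e * real q ^ (r - 1) / q - e / q - 1) / (real q - 1)"

lemma three_eigenvalue_relation_adj:
  assumes "r \<ge> 2"
  shows "three_eigenvalue_relation points adj (real q ^ (r - 1)) (- e / q) shift_const valency"
proof
  obtain m where m: "r = Suc (Suc m)"
    using assms by (metis Suc_le_D numeral_2_eq_2 Suc_le_mono)
  define w where "w = real q ^ m"
  define f where "f = e / q"
  have q: "real q > 1"
    using q_ge_2 by simp
  then have e: "e = f * q"
    by (simp add: f_def)
  have f: "f > 0"
    using e_pos q by (simp add: f_def)
  have w: "w \<ge> 1"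
    using q by (simp add: w_def)
  have pow: "real q ^ r = q * q * w" "real q ^ (r - 1) = q * w" "real q ^ (r - 2) = w"
    by (simp_all add: m w_def)
  have "(real q - 1) * valency = q * q * w + e * (q * w) - e - 1"
    unfolding valency_def pow using q by simp
  then have valency: "(real q - 1) * valency = q * q * w + f * q * q * w - f * q - 1"
    by (simp add: e)
  have "(real q - 1) * shift_const = q * w + e * (q * w) / q - e / q - 1"
    unfolding shift_const_def pow using q by simp
  then have shift: "(real q - 1) * shift_const = q * w + f * q * w - f - 1"
    using q by (simp add: e)
  have row: "real (card {R \<in> points. R \<subseteq> perp P}) = valency" if "P \<in> points" for P
    using card_points_subset_perp[of P] that q by (simp add: points_iff valency_def field_simps)
  have row_sum: "(\<Sum>R\<in>points. adj P R) = real (card {R \<in> points. R \<subseteq> perp P})" for P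
    using finite_subspaces by (simp add: adj_def of_bool_def sum.If_cases Int_def)
  show "finite points"
    by (rule finite_subspaces)
  show "points \<noteq> {}"
  proof
    assume "points = {}"
    then have "(real q ^ r - 1) * (e + 1) = 0"
      using card_points by simp
    moreover have "real q ^ r > 1"
      using q m by (intro one_less_power) auto
    ultimately show False
      using e_pos by simp
  qed
  have signs: "real q ^ (r - 1) > 0" "- e / q < 0"
    using q e_pos by simp_all
  then show "real q ^ (r - 1) \<noteq> - e / q"
    by linarith
  have "(real q - 1) * (valency - real q ^ (r - 1)) = (f * q + 1) * (q * w - 1)"
    unfolding right_diff_distrib valency pow by (simp add: algebra_simps)
  moreover have "(f * q + 1) * (q * w - 1) > 0"
  proof (rule mult_pos_pos)
    show "q * w - 1 > 0"
      using mult_left_mono[OF w, of "real q"] q by linarith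
    show "f * q + 1 > 0"
      using f q by (intro add_pos_pos) auto
  qed
  ultimately have "0 < (real q - 1) * (valency - real q ^ (r - 1))"
    by (simp only:)
  then have less: "valency > real q ^ (r - 1)"
    using zero_less_mult_pos[of "real q - 1" "valency - real q ^ (r - 1)"] q by linarith
  then show "real q ^ (r - 1) \<noteq> valency"
    by simp
  from less signs show "- e / q \<noteq> valency"
    by linarith
  fix P assume P: "P \<in> points"
  show "adj P P = 1"
    using P tsing_subset_perp[of P] by (simp add: adj_def points_iff)
  show "(\<Sum>R\<in>points. adj P R) = valency"
    using row_sum row[OF P] by simp
  fix R assume R: "R \<in> points"
  show "adj P R = adj R P" "adj P R \<in> {0, 1}"
    by (auto simp: adj_def subset_perp_sym[of P R])
  have "(\<Sum>S\<in>points. adj P S * adj S R) = real (card {S \<in> points. S \<subseteq> perp P \<and> S \<subseteq> perp R})"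
  proof -
    have "adj P S * adj S R = (if S \<subseteq> perp P \<and> S \<subseteq> perp R then 1 else 0)" for S
      unfolding adj_def subset_perp_sym[of R S] by simp
    then show ?thesis
      using finite_subspaces by (simp add: sum.If_cases Int_def)
  qed
  also have "\<dots> = real (card {S \<in> points. S \<subseteq> perp (P \<union> R)})"
    by (simp add: perp_Un)
  also have "\<dots> = (real q ^ (r - 1) + - e / q) * adj P R - real q ^ (r - 1) * (- e / q) * of_bool (P = R) + shift_const"
    (is "?l = ?r")
  proof -
    have rhs: "(real q - 1) * ?r = (real q - 1) * (q * w - f) * adj P R + (real q - 1) * (q * w * f) * of_bool (P = R) +
        (q * w + f * q * w - f - 1)"
      unfolding pow shift[symmetric] using q by (simp add: e algebra_simps)
    consider "P = R" | "P \<noteq> R" "R \<subseteq> perp P" | "P \<noteq> R" "\<not> R \<subseteq> perp P"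
      by blast
    then have "(real q - 1) * ?l = (real q - 1) * ?r"
    proof cases
      case 1
      then have "adj P R = 1"
        using P tsing_subset_perp[of P] by (simp add: adj_def points_iff)
      then show ?thesis
        unfolding rhs using 1 row[OF P] valency by (simp add: algebra_simps)
    next
      case 2
      note S = tsing_span_two_points[OF P R 2]
      have "(real q - 1) * ?l = q * q * w + f * q * w - f * q - 1"
        using card_points_subset_perp[OF S(1)] unfolding perp_span S(2) pow e .
      also have "\<dots> = (real q - 1) * ?r"
        unfolding rhs using 2 by (simp add: adj_def algebra_simps)
      finally show ?thesis .
    next
      case 3
      obtain u where u: "sing u" "perp P = perp {u}" "P = span {u}"
        using P by (rule pointE) auto
      obtain v where v: "sing v" "perp R = perp {v}" "R = span {v}"
        using R by (rule pointE) auto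
      have uv: "perp (P \<union> R) = perp {u, v}"
        using u v perp_Un[of "{u}" "{v}"] by (simp add: perp_Un insert_commute)
      have "B u v \<noteq> 0"
      proof
        assume "B u v = 0"
        then have "{v} \<subseteq> perp {u}"
          using B_sym by (auto simp: perp_def)
        then have "R \<subseteq> perp P"
          unfolding v u(2) by (intro span_minimal subspace_perp)
        with 3 show False
          by simp
      qed
      then have "num_sing_perp {u} = q * num_sing_perp {u, v}"
        using u by (intro num_sing_perp_hyperbolic)
      moreover have "num_sing_perp {u} = num_sing_perp P"
        by (simp only: num_sing_perp_def u(2))
      moreover have "real (num_sing_perp P) = q * q * w + f * q * (q * w) - f * q"
      proof -
        have "tsing P" "dim P = 1"
          using P by (simp_all add: points_iff)
        then have "real (num_sing_perp P) = real q ^ r + e * real q ^ (r - 1) - e"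
          using num_sing_perp_eq[of P] by simp
        then show ?thesis
          unfolding pow e by (simp only:)
      qed
      ultimately have "real q * real (num_sing_perp {u, v}) = q * q * w + f * q * (q * w) - f * q"
        by (metis of_nat_mult)
      also have "\<dots> = q * (q * w + f * q * w - f)"
        by (simp add: algebra_simps)
      finally have "real q * real (num_sing_perp {u, v}) = q * (q * w + f * q * w - f)" .
      then have "real (num_sing_perp {u, v}) = q * w + f * q * w - f"
        using q by simp
      then show ?thesis
        unfolding rhs using 3 card_points_subset[OF subspace_perp, of "{u, v}"]
        by (simp add: uv adj_def num_sing_perp_def)
    qed
    then show ?thesis
      using q by simp
  qed
  finally show "(\<Sum>S\<in>points. adj P S * adj S R) =
    (real q ^ (r - 1) + - e / q) * adj P R - real q ^ (r - 1) * (- e / q) * of_bool (P = R) + shift_const" .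
qed

lemma polar_rank_eq: "polar_rank (Collect tsing) = r"
  unfolding polar_rank_def
  by (rule Max_eqI) (use max_tsing dim_tsing finite_subspaces in auto)

lemma order_collinearity_matrix:
  assumes "r \<ge> 2"
  shows "real (polar_m1 (Collect tsing)) =
    (card points * (1 + e / q) - (valency + e / q)) / (real q ^ (r - 1) + e / q)"
proof -
  define ps where "ps = (SOME ps. distinct ps \<and> set ps = points)"
  have "\<exists>ps. distinct ps \<and> set ps = points"
    using finite_distinct_list[OF finite_subspaces[of points]] by blast
  then have ps: "distinct ps" "set ps = points"
    unfolding ps_def by (metis (mono_tags, lifting) someI_ex)+
  have bij: "bij_betw (\<lambda>i. ps ! i) {..<length ps} points"
    using bij_betw_nth[of ps] ps by simp
  interpret three_eigenvalue_relation points adj "real q ^ (r - 1)" "- e / q" shift_const valency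
    by (rule three_eigenvalue_relation_adj[OF assms])
  have "collinearity_matrix (Collect tsing) =
      mat (length ps) (length ps) (\<lambda>(i, j). if collinear (Collect tsing) (ps ! i) (ps ! j) then 1 else 0)"
    by (simp add: collinearity_matrix_def Let_def flip: ps_def)
  also have "\<dots> = mat (length ps) (length ps) (\<lambda>(i, j). adj (ps ! i) (ps ! j) - of_bool (i = j))"
  proof (rule cong_mat)
    fix i j assume ij: "i < length ps" "j < length ps"
    then have mem: "ps ! i \<in> points" "ps ! j \<in> points"
      using ps nth_mem by blast+
    have "i = j \<longleftrightarrow> ps ! i = ps ! j"
      using ij ps(1) by (simp add: nth_eq_iff_index_eq)
    then show "(\<lambda>(i, j). if collinear (Collect tsing) (ps ! i) (ps ! j) then 1 else 0) (i, j) =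
        (\<lambda>(i, j). adj (ps ! i) (ps ! j) - of_bool (i = j)) (i, j)"
      using mem M_diag[of "ps ! i"] by (auto simp: collinear_iff adj_def)
  qed auto
  finally have A: "collinearity_matrix (Collect tsing) = \<dots>" .
  have "length ps = card points"
    using distinct_card[OF ps(1)] ps(2) by simp
  then show ?thesis
    using order_char_poly_shift[OF reindex[OF bij]] unfolding polar_m1_def polar_rank_eq A q_eq[symmetric]
    by simp
qed

text \<open>Both sides count the pairs of a vector \<open>x \<notin> S\<close> and a block containing \<open>S\<close> and \<open>x\<close>.\<close>

lemma design_flag_count:
  assumes D: "\<And>U. U \<in> D \<Longrightarrow> tsing U \<and> dim U = k"
    and design: "\<And>T. tsing T \<Longrightarrow> dim T = Suc s \<Longrightarrow> real (card {U \<in> D. T \<subseteq> U}) = l"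
    and S: "tsing S" "dim S = s"
  shows "real (card {U \<in> D. S \<subseteq> U}) * (real q ^ k - real q ^ s) =
    l * (real q ^ r + e * real q ^ (r - s) - e - real q ^ s)"
proof -
  have sub: "subspace S"
    using S by (simp add: tsing_def)
  let ?X = "{x \<in> perp S. sing x} - S" and ?D = "{U \<in> D. S \<subseteq> U}"
  have fin: "finite (A :: 'v set)" for A
    by (rule finite_vectors)
  have card_S: "card S = q ^ s"
    using card_subspace[OF sub] S by (simp add: q_eq)
  have "(\<Sum>x\<in>?X. card {U \<in> ?D. x \<in> U}) = (q ^ k - q ^ s) * card ?D"
  proof (intro sum_multicount ballI fin finite_subspaces)
    fix U assume U: "U \<in> ?D"
    then have "{x \<in> ?X. x \<in> U} = U - S"
      using D[of U] by (auto simp: tsing_def perp_def)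
    moreover have "card U = q ^ k"
      using card_subspace[of U] D[of U] U by (auto simp: tsing_def q_eq)
    ultimately show "card {x \<in> ?X. x \<in> U} = q ^ k - q ^ s"
      using U card_Diff_subset[of S U] fin card_S by simp
  qed
  then have "real (\<Sum>x\<in>?X. card {U \<in> ?D. x \<in> U}) = real (q ^ k - q ^ s) * card ?D"
    by simp
  moreover have "real (card {U \<in> ?D. x \<in> U}) = l" if x: "x \<in> ?X" for x
  proof -
    have "{U \<in> ?D. x \<in> U} = {U \<in> D. span (insert x S) \<subseteq> U}"
    proof (rule Collect_cong)
      fix U
      show "U \<in> ?D \<and> x \<in> U \<longleftrightarrow> U \<in> D \<and> span (insert x S) \<subseteq> U"
        using D[of U] span_subset_iff[of U "insert x S"] by (cases "U \<in> D") (simp_all add: tsing_def conj_commute)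
    qed
    then show ?thesis
      using design[of "span (insert x S)"] tsing_span_insert[OF S(1), of x] dim_span_insert[OF sub, of x]
        x S by simp
  qed
  ultimately have "l * card ?X = real (q ^ k - q ^ s) * card ?D"
    by (simp add: mult.commute)
  moreover have "real (card ?X) = real q ^ r + e * real q ^ (r - s) - e - real q ^ s"
  proof -
    have sub: "S \<subseteq> {x \<in> perp S. sing x}"
      using S tsing_subset_perp[of S] by (auto simp: tsing_def)
    then have "card S \<le> card {x \<in> perp S. sing x}"
      by (intro card_mono fin)
    then show ?thesis
      using num_sing_perp_eq[OF S(1)] S(2) card_S
      by (simp add: card_Diff_subset[OF fin sub] num_sing_perp_def of_nat_diff)
  qed
  moreover have "real (q ^ k - q ^ s) * card ?D = (real q ^ k - real q ^ s) * card ?D"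
  proof (cases "?D = {}")
    case False
    then obtain U where "U \<in> D" "S \<subseteq> U"
      by blast
    then have "card S \<le> q ^ k"
      using card_mono[OF fin, of S U] card_subspace[of U] D[of U] by (auto simp: tsing_def q_eq)
    then show ?thesis
      by (simp add: card_S of_nat_diff)
  next
    case True
    then show ?thesis
      by (simp only: card.empty of_nat_0 mult_zero_right)
  qed
  ultimately show ?thesis
    by (simp add: mult.commute)
qed

lemma exists_tsing:
  assumes "s \<le> r"
  shows "\<exists>S. tsing S \<and> dim S = s"
proof -
  obtain U where U: "tsing U" "dim U = r"
    using max_tsing by blast
  obtain T where T: "T \<subseteq> U" "independent T" "U \<subseteq> span T" "card T = dim U"
    by (rule basis_exists)
  then have "s \<le> card T"
    using assms U by simp
  then obtain T' where T': "T' \<subseteq> T" "card T' = s"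
    by (rule obtain_subset_with_card_n)
  have "span T' \<subseteq> U"
    using T T' U by (intro span_minimal) (auto simp: tsing_def)
  moreover have "dim (span T') = s"
    using T T' dim_span_eq_card_independent independent_mono by blast
  ultimately show ?thesis
    using U by (intro exI[of _ "span T'"]) (auto simp: tsing_def)
qed

lemma flag_count_pos:
  assumes "s < r"
  shows "real q ^ r + e * real q ^ (r - s) - e - real q ^ s > 0"
proof -
  have q: "real q > 1"
    using q_ge_2 by simp
  have "real q ^ s < real q ^ r"
    using assms q by simp
  moreover have "e * 1 \<le> e * real q ^ (r - s)"
    using e_pos q by (intro mult_left_mono one_le_power) auto
  ultimately show ?thesis
    by simp
qed

lemma design_reduce_strength:
  assumes D: "\<And>U. U \<in> D \<Longrightarrow> tsing U \<and> dim U = k"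
    and design: "\<And>T. tsing T \<Longrightarrow> dim T = t \<Longrightarrow> real (card {U \<in> D. T \<subseteq> U}) = l"
    and "l > 0" "t \<le> r" "t \<le> k" "s \<le> t"
  shows "\<exists>l > 0. \<forall>T. tsing T \<longrightarrow> dim T = s \<longrightarrow> real (card {U \<in> D. T \<subseteq> U}) = l"
  using \<open>s \<le> t\<close>
proof (induction rule: inc_induct)
  case base
  then show ?case
    using assms by blast
next
  case (step n)
  then obtain l where l: "l > 0" "\<And>T. tsing T \<Longrightarrow> dim T = Suc n \<Longrightarrow> real (card {U \<in> D. T \<subseteq> U}) = l"
    by blast
  have k: "real q ^ k - real q ^ n > 0"
    using q_ge_2 step.hyps assms by simp
  let ?Z = "real q ^ r + e * real q ^ (r - n) - e - real q ^ n"
  have "l * ?Z / (real q ^ k - real q ^ n) > 0"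
    using l(1) k flag_count_pos[of n] step.hyps assms by simp
  moreover have "real (card {U \<in> D. T \<subseteq> U}) = l * ?Z / (real q ^ k - real q ^ n)"
    if "tsing T" "dim T = n" for T
  proof (rule eq_divide_imp)
    show "real (card {U \<in> D. T \<subseteq> U}) * (real q ^ k - real q ^ n) = l * ?Z"
      by (rule design_flag_count[OF D l(2) that])
  qed (use k in simp)
  ultimately show ?case
    by blast
qed

theorem design_bounds:
  assumes design: "polar_design (Collect tsing) t r k lam D" and lam: "lam \<ge> 1" and t: "t \<ge> 2"
  shows "k < r \<Longrightarrow> card points \<le> card D"
    and "k = r \<Longrightarrow> 1 + polar_m1 (Collect tsing) \<le> card D"
proof -
  have q: "real q > 1"
    using q_ge_2 by simp
  have D: "tsing U \<and> dim U = k" if "U \<in> D" for U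
    using design that by (auto simp: polar_design_def)
  have tr: "t \<le> r" "k \<le> r" and lam': "\<And>T. tsing T \<Longrightarrow> dim T = t \<Longrightarrow> card {U \<in> D. T \<subseteq> U} = lam"
    using design by (auto simp: polar_design_def)
  then have r: "r \<ge> 2"
    using t by simp
  have "t \<le> k"
  proof -
    obtain T where T: "tsing T" "dim T = t"
      using exists_tsing[OF tr(1)] by blast
    then have "{U \<in> D. T \<subseteq> U} \<noteq> {}"
      using lam'[of T] lam by (metis card.empty not_one_le_zero)
    then obtain U where "U \<in> D" "T \<subseteq> U"
      by blast
    then show ?thesis
      using D[of U] T dim_subset[of T U] by simp
  qed
  then have k: "k \<ge> 2"
    using t by simp
  have "\<exists>l > 0. \<forall>T. tsing T \<longrightarrow> dim T = 2 \<longrightarrow> real (card {U \<in> D. T \<subseteq> U}) = l"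
    by (rule design_reduce_strength[OF D, where t = t and l = "real lam"]) (use lam' lam t tr \<open>t \<le> k\<close> in auto)
  then obtain l2 where l2: "l2 > 0" "\<And>T. tsing T \<Longrightarrow> dim T = 2 \<Longrightarrow> real (card {U \<in> D. T \<subseteq> U}) = l2"
    by blast
  define l1 where "l1 = l2 * (real q ^ r + e * real q ^ (r - 1) - e - real q) / (real q ^ k - real q)"
  have k1: "real q ^ k - real q > 0"
    using power_strict_increasing[of 1 k "real q"] q k by simp
  have l1: "real (card {U \<in> D. P \<subseteq> U}) = l1" if "P \<in> points" for P
  proof -
    have P: "tsing P" "dim P = 1"
      using that by (simp_all add: points_iff)
    have "real (card {U \<in> D. P \<subseteq> U}) * (real q ^ k - real q ^ 1) =
        l2 * (real q ^ r + e * real q ^ (r - 1) - e - real q ^ 1)"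
      by (rule design_flag_count[OF D _ P]) (use l2(2) in auto)
    then show ?thesis
      unfolding l1_def power_one_right using k1 by (intro eq_divide_imp) auto
  qed
  define f where "f = e / q"
  have f: "f > 0" "e = f * q"
    using e_pos q by (simp_all add: f_def)
  have pow: "real q ^ r = q * real q ^ (r - 1)"
    using r by (cases r) auto
  have "l1 * (real q ^ k - real q) = l2 * (real q ^ r + e * real q ^ (r - 1) - e - real q)"
    using k1 by (simp add: l1_def)
  also have "\<dots> = l2 * (1 + f) * (real q ^ r - real q)"
    unfolding pow f(2) by (simp add: algebra_simps)
  finally have "l1 * (real q ^ k - real q) = l2 * (1 + f) * (real q ^ r - real q)" .
  then have l1_eq: "l1 = l2 * (1 + f) * ((real q ^ r - real q) / (real q ^ k - real q))"
    unfolding times_divide_eq_right using k1 by (intro eq_divide_imp) auto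
  have g2_zero: "l1 - l2 - l2 * f = 0" if "k = r"
    using l1_eq that k1 by (simp add: algebra_simps)
  have g2_pos: "l1 - l2 - l2 * f > 0" if "k < r"
  proof -
    have "real q ^ k < real q ^ r"
      using that q by simp
    then have "1 < (real q ^ r - real q) / (real q ^ k - real q)"
      using k1 by (simp add: field_simps)
    then have "l2 * (1 + f) * 1 < l1"
      unfolding l1_eq using l2(1) f(1) by (intro mult_strict_left_mono) auto
    then show ?thesis
      by (simp add: algebra_simps)
  qed
  have "l1 - l2 > 0"
    using g2_zero g2_pos tr(2) mult_pos_pos[OF l2(1) f(1)] by (cases "k = r") auto
  interpret three_eigenvalue_relation points adj "real q ^ (r - 1)" "- e / q" shift_const valency
    by (rule three_eigenvalue_relation_adj[OF r])
  have "valency \<ge> 0"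
  proof -
    obtain P where "P \<in> points"
      using nonempty_X by blast
    then show ?thesis
      using sum_nonneg[of points "adj P"] M_row[of P] by (simp add: adj_def)
  qed
  define g0 g1 g2 where "g0 = l1 - l2 + l2 * valency" and "g1 = l1 - l2 + l2 * real q ^ (r - 1)"
    and "g2 = l1 - l2 + l2 * (- e / q)"
  have pos: "g0 > 0" "g1 > 0"
    unfolding g0_def g1_def using \<open>l1 - l2 > 0\<close> l2(1) \<open>valency \<ge> 0\<close> q
    by (auto intro!: add_pos_nonneg mult_nonneg_nonneg)
  have g2: "g2 = l1 - l2 - l2 * f"
    by (simp add: g2_def f_def)
  have gram: "(\<Sum>U\<in>D. of_bool (P \<subseteq> U) * of_bool (R \<subseteq> U)) = spectral g0 g1 g2 P R"
    if PR: "P \<in> points" "R \<in> points" for P R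
  proof -
    have "(\<Sum>U\<in>D. of_bool (P \<subseteq> U) * of_bool (R \<subseteq> U)) = real (card {U \<in> D. P \<subseteq> U \<and> R \<subseteq> U})"
    proof -
      have "of_bool (P \<subseteq> U) * of_bool (R \<subseteq> U) = (if P \<subseteq> U \<and> R \<subseteq> U then 1 else 0 :: real)" for U
        by simp
      then show ?thesis
        using finite_subspaces[of D] by (simp add: sum.If_cases Int_def)
    qed
    also have "\<dots> = comb (l1 - l2) l2 0 P R"
    proof -
      consider "P = R" | "P \<noteq> R" "R \<subseteq> perp P" | "P \<noteq> R" "\<not> R \<subseteq> perp P"
        by blast
      then show ?thesis
      proof cases
        case 1
        then show ?thesis
          using l1[OF PR(1)] M_diag[OF PR(1)] by (simp add: comb_def)
      next
        case 2
        have "{U \<in> D. P \<subseteq> U \<and> R \<subseteq> U} = {U \<in> D. span (P \<union> R) \<subseteq> U}"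
        proof (rule Collect_cong)
          fix U
          show "U \<in> D \<and> P \<subseteq> U \<and> R \<subseteq> U \<longleftrightarrow> U \<in> D \<and> span (P \<union> R) \<subseteq> U"
            using D[of U] span_subset_iff[of U "P \<union> R"] by (cases "U \<in> D") (simp_all add: tsing_def)
        qed
        then show ?thesis
          using l2(2) tsing_span_two_points[OF PR 2] 2 by (simp add: comb_def adj_def)
      next
        case 3
        then have empty: "{U \<in> D. P \<subseteq> U \<and> R \<subseteq> U} = {}"
          using D by (fastforce simp: tsing_def perp_def)
        show ?thesis
          unfolding empty using 3 by (simp add: comb_def adj_def)
      qed
    qed
    finally show ?thesis
      by (simp add: comb_eq_spectral g0_def g1_def g2_def)
  qed
  have bound: "(\<Sum>P\<in>points. spectral (g0 / g0) (g1 / g1) (g2 / g2) P P) \<le> card D"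
    by (rule card_ge_spectral_trace[OF finite_subspaces gram])
  show "card points \<le> card D" if "k < r"
    using bound pos g2_pos[OF that] spectral_trace(1) by (simp add: g2 N_def)
  show "1 + polar_m1 (Collect tsing) \<le> card D" if "k = r"
  proof -
    have "1 + real (polar_m1 (Collect tsing)) \<le> card D"
      using bound pos g2_zero[OF that] spectral_trace(2) order_collinearity_matrix[OF r]
      by (simp add: g2 N_def)
    then show ?thesis
      by linarith
  qed
qed

lemma polar_m1_eq:
  assumes "r \<ge> 2"
  shows "real (polar_m1 (Collect tsing)) =
    (real q ^ r - 1) / (real q - 1) * (e * (real q + e) / (real q ^ r + e))"
proof -
  have q: "real q > 1"
    using q_ge_2 by simp
  define f where "f = e / q"
  have f: "f > 0" "e = f * q"
    using e_pos q by (simp_all add: f_def)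
  define w where "w = real q ^ (r - 1)"
  have pow: "real q ^ r = q * w"
    using assms by (cases r) (auto simp: w_def)
  have w: "w > 0"
    using q by (simp add: w_def)
  have N: "(real q - 1) * card points = (q * w - 1) * (f * q + 1)"
    using card_points f pow by simp
  have v: "(real q - 1) * valency = q * w + f * q * w - f * q - 1"
  proof -
    have "(real q - 1) * valency = q * w + e * w - e - 1"
      unfolding valency_def pow w_def[symmetric] using q by simp
    then show ?thesis
      by (simp add: f(2))
  qed
  have "(real q - 1) * (card points * (1 + f) - (valency + f)) =
      (q * w - 1) * (f * q + 1) * (1 + f) - (q * w + f * q * w - f * q - 1) - (real q - 1) * f"
    unfolding N[symmetric] v[symmetric] by (simp add: algebra_simps)
  also have "\<dots> = (q * w - 1) * f * (q + f * q)"
    by (simp add: algebra_simps)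
  finally have num: "card points * (1 + f) - (valency + f) = (q * w - 1) * f * (q + f * q) / (real q - 1)"
    using q by (simp add: field_simps)
  have "real (polar_m1 (Collect tsing)) = (card points * (1 + f) - (valency + f)) / (w + f)"
    unfolding order_collinearity_matrix[OF assms] w_def f_def ..
  also have "\<dots> = (q * w - 1) / (real q - 1) * ((f * q) * (q + f * q) / (q * w + f * q))"
  proof -
    have "(f * q) * (q + f * q) / (q * w + f * q) = q * (f * (q + f * q)) / (q * (w + f))"
      by (simp add: algebra_simps)
    also have "\<dots> = f * (q + f * q) / (w + f)"
      using q by (subst mult_divide_mult_cancel_left) auto
    finally show ?thesis
      unfolding num by simp
  qed
  finally show ?thesis
    by (simp add: pow f(2))
qed

end

section \<open>Alternating, quadratic and Hermitian forms\<close>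

lemma prime_divisor_card_eq_CHAR:
  assumes "prime l" "l dvd CARD('a :: {field,finite})"
  shows "l = CHAR('a)"
proof -
  define G :: "'a monoid" where "G = \<lparr>carrier = UNIV, monoid.mult = (+), one = 0\<rparr>"
  have "group G"
    by (rule groupI) (auto simp: G_def add.assoc intro: exI[of _ "- _"] left_minus)
  then interpret group G .
  obtain m where "order G = l ^ 1 * m"
    using assms(2) by (auto simp: order_def G_def)
  then obtain H where H: "subgroup H G" "card H = l ^ 1"
    using sylow_thm[OF assms(1) \<open>group G\<close>, of 1 m] by (auto simp: G_def)
  have "\<not> H \<subseteq> {0}"
    using H(2) card_mono[of "{0 :: 'a}" H] prime_ge_2_nat[OF assms(1)] by auto
  then obtain x where x: "x \<in> H" "x \<noteq> 0"
    by blast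
  have pow: "x [^]\<^bsub>G\<lparr>carrier := H\<rparr>\<^esub> n = of_nat n * x" for n :: nat
    by (induction n) (simp_all add: nat_pow_def G_def algebra_simps)
  interpret HG: group "G\<lparr>carrier := H\<rparr>"
    using subgroup.subgroup_is_group[OF H(1) \<open>group G\<close>] .
  have "of_nat l * x = 0"
    using HG.pow_order_eq_1[of x] x H(2) unfolding pow by (simp add: order_def G_def)
  then have "CHAR('a) dvd l"
    using x by (simp add: of_nat_eq_0_iff_char_dvd)
  moreover have "prime CHAR('a)"
    by (intro prime_CHAR_semidom finite_imp_CHAR_pos) auto
  ultimately show ?thesis
    using assms(1) by (metis primes_dvd_imp_eq)
qed

lemma power_add_if_square_card:
  fixes x y :: "'a :: {field,finite}"
  assumes "q0\<^sup>2 = CARD('a)"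
  shows "(x + y) ^ q0 = x ^ q0 + y ^ q0"
proof -
  have prime: "prime CHAR('a)"
    by (intro prime_CHAR_semidom finite_imp_CHAR_pos) auto
  have "\<exists>n. normalize q0 = CHAR('a) ^ n"
  proof (rule ccontr)
    assume "\<nexists>n. normalize q0 = CHAR('a) ^ n"
    moreover have "q0 \<noteq> 0"
      using assms by (intro notI) simp
    ultimately obtain l where l: "l \<in> prime_factors q0" "l \<noteq> CHAR('a)"
      using Ex_other_prime_factor[of q0 "CHAR('a)"] prime by blast
    then have "l dvd q0\<^sup>2" "prime l"
      by (auto simp: power2_eq_square in_prime_factors_iff)
    then show False
      using l prime_divisor_card_eq_CHAR[where 'a = 'a] assms by metis
  qed
  then obtain n where "q0 = CHAR('a) ^ n"
    by auto
  then show ?thesis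
    by (rule freshmans_dream'[OF prime])
qed

lemma power_card_field: "(x :: 'a :: {field,finite}) ^ CARD('a) = x"
proof (cases "x = 0")
  case False
  have "(\<Prod>y\<in>UNIV - {0}. x * y) = (\<Prod>y\<in>UNIV - {0 :: 'a}. y)"
    by (rule prod.reindex_bij_witness[of _ "\<lambda>y. y / x" "(*) x"]) (use False in auto)
  moreover have "(\<Prod>y\<in>UNIV - {0 :: 'a}. y) \<noteq> 0"
    by simp
  ultimately have "x ^ (CARD('a) - 1) = 1"
    by (simp add: prod.distrib)
  moreover have "CARD('a) = Suc (CARD('a) - 1)"
    by simp
  ultimately show ?thesis
    by (metis mult.right_neutral power_Suc)
qed simp

lemma card_trace_fibre:
  fixes c :: "'a :: {field,finite}"
  assumes q0: "q0\<^sup>2 = CARD('a)" and c: "c ^ q0 = c"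
  shows "card {a. a + a ^ q0 = c} = q0"
proof -
  have "card {0, 1 :: 'a} \<le> CARD('a)"
    by (rule card_mono) auto
  then have "2 \<le> q0\<^sup>2"
    using q0 by simp
  then have ge: "q0 \<ge> 2"
    by (cases "q0 = 0 \<or> q0 = 1") auto
  have bound: "card {a. a ^ q0 = u * a + v} \<le> q0" for u v :: 'a
  proof -
    obtain m where m: "q0 = Suc (Suc m)"
      using ge by (metis Suc_le_D numeral_2_eq_2 Suc_le_mono)
    define p where "p = Polynomial.monom 1 q0 + [:- v, - u:]"
    have "Polynomial.coeff p q0 = 1"
      by (simp add: p_def m)
    then have "p \<noteq> 0"
      by auto
    moreover have "Polynomial.degree p \<le> q0"
      unfolding p_def using ge by (intro degree_add_le degree_monom_le) (auto intro: order_trans[OF degree_pCons_le])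
    moreover have "poly p a = 0 \<longleftrightarrow> a ^ q0 = u * a + v" for a
      by (simp add: p_def poly_monom algebra_simps)
    ultimately show ?thesis
      using card_poly_roots_bound[of p] by simp
  qed
  have fibre: "card {a. a + a ^ q0 = d} \<le> q0" for d :: 'a
    using bound[of "- 1" d] by (simp add: algebra_simps)
  define F where "F = {d :: 'a. d ^ q0 = d}"
  have F: "card F \<le> q0"
    using bound[of 1 0] by (simp add: F_def)
  have "(a + a ^ q0) ^ q0 = a + a ^ q0" for a :: 'a
    using power_card_field[of a]
    by (simp add: power_add_if_square_card[OF q0] flip: power_mult power2_eq_square q0)
  then have trace: "a + a ^ q0 \<in> F" for a :: 'a
    by (simp add: F_def)
  have "{d \<in> F. a + a ^ q0 = d} = {a + a ^ q0}" for a
    using trace by auto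
  then have "CARD('a) = (\<Sum>d\<in>F. card {a. a + a ^ q0 = d})"
    using sum_multicount_gen[of UNIV F "\<lambda>a d. a + a ^ q0 = d"] by simp
  also have "\<dots> = card {a. a + a ^ q0 = c} + (\<Sum>d\<in>F - {c}. card {a. a + a ^ q0 = d})"
    using c by (intro sum.remove) (auto simp: F_def)
  also have "(\<Sum>d\<in>F - {c}. card {a. a + a ^ q0 = d}) \<le> card (F - {c}) * q0"
    using sum_bounded_above[of "F - {c}" "\<lambda>d. card {a. a + a ^ q0 = d}" q0] fibre by simp
  also have "card (F - {c}) * q0 \<le> (q0 - 1) * q0"
    using F c by (intro mult_right_mono) (auto simp: F_def)
  finally have "q0\<^sup>2 \<le> card {a. a + a ^ q0 = c} + (q0 - 1) * q0"
    by (simp add: q0)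
  moreover have "q0\<^sup>2 = q0 + (q0 - 1) * q0"
    using ge by (cases q0) (auto simp: power2_eq_square)
  ultimately show ?thesis
    using fibre[of c] by linarith
qed

context finite_field_space
begin

lemma linear_functionalD:
  assumes "Vector_Spaces.linear scale (*) f"
  shows "f (x + y) = f x + f y" "f (scale c x) = c * f x"
  using assms by (auto simp: Vector_Spaces.linear_def Modules.module_hom_def Modules.module_hom_axioms_def)

lemma polar_form_alternating:
  assumes alt: "alternating_form B" and "nondegenerate B"
  shows "polar_form scale Basis B (\<lambda>_. True) CARD('a) CARD('a)"
    and "totally_isotropic_subspaces B = Collect (polar_form.tsing scale B (\<lambda>_. True))"
proof -
  have left: "B (x + y) z = B x z + B y z" "B (scale c x) z = c * B x z"
    and right: "B x (y + z) = B x y + B x z" and self: "B x x = 0" for x y z c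
    using alt linear_functionalD[of "\<lambda>x. B x z"] linear_functionalD[of "B x"]
    by (auto simp: alternating_form_def bilinear_form_def)
  have anti: "B y x = - B x y" for x y
  proof -
    have "B (x + y) (x + y) = B y x + B x y"
      by (simp only: left right) (simp add: self)
    then show ?thesis
      by (simp add: self eq_neg_iff_add_eq_0)
  qed
  show "polar_form scale Basis B (\<lambda>_. True) CARD('a) CARD('a)"
  proof unfold_locales
    show "B y x = 0" if "B x y = 0" for x y
      using anti[of y x] that by simp
  qed (use assms(2) in \<open>auto simp: left self nondegenerate_def\<close>)
  then interpret polar_form scale Basis B "\<lambda>_. True" "CARD('a)" "CARD('a)" .
  show "totally_isotropic_subspaces B = Collect tsing"
    by (auto simp: totally_isotropic_subspaces_def tsing_def)
qed

lemma polar_form_quadratic: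
  assumes f: "quadratic_form f" and "nonsingular f"
  shows "polar_form scale Basis (polarization f) (\<lambda>x. f x = 0) CARD('a) 1"
    and "totally_singular_subspaces f = Collect (polar_form.tsing scale (polarization f) (\<lambda>x. f x = 0))"
proof -
  let ?B = "polarization f"
  have scale: "f (scale c x) = c\<^sup>2 * f x" for c x
    using f by (simp add: quadratic_form_def)
  have left: "?B (x + y) z = ?B x z + ?B y z" "?B (scale c x) z = c * ?B x z" for x y z c
    using f linear_functionalD[of "\<lambda>x. ?B x z"] by (auto simp: quadratic_form_def bilinear_form_def)
  have add: "f (x + y) = f x + f y + ?B x y" for x y
    by (simp add: polarization_def)
  have sym: "?B x y = ?B y x" for x y
    by (simp add: polarization_def add.commute)
  have zero: "f 0 = 0"
    using scale[of 0 0] by simp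
  have self: "?B x x = 0" if "f x = 0" for x
  proof -
    have "x + x = scale (1 + 1) x"
      by (simp only: scale_left_distrib scale_one)
    then show ?thesis
      using that by (simp only: polarization_def scale) simp
  qed
  show "polar_form scale Basis ?B (\<lambda>x. f x = 0) CARD('a) 1"
  proof unfold_locales
    show "?B y x = 0" if "?B x y = 0" for x y
      using sym[of y x] that by simp
  next
    fix S s y
    assume S: "subspace S" "\<And>x y. x \<in> S \<Longrightarrow> y \<in> S \<Longrightarrow> f x = 0 \<and> ?B x y = 0" "s \<in> S" "?B s y \<noteq> 0"
    have "{s \<in> S. f (y + s) = 0} = {s \<in> S. ?B s y = - f y}"
      using S(2) by (auto simp: add sym[of y] eq_neg_iff_add_eq_0 add.commute)
    then show "CARD('a) * card {s \<in> S. f (y + s) = 0} = 1 * card S"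
      using card_functional_fibre[of S "\<lambda>x. ?B x y" s "- f y"] S left by simp
  qed (use assms(2) in \<open>auto simp: left scale zero self add nonsingular_def\<close>)
  then interpret polar_form scale Basis ?B "\<lambda>x. f x = 0" "CARD('a)" 1 .
  show "totally_singular_subspaces f = Collect tsing"
    by (auto simp: totally_singular_subspaces_def tsing_def polarization_def subspace_add)
qed

lemma polar_form_hermitian:
  assumes "hermitian_form h" and "nondegenerate h"
  shows "\<exists>q0. q0\<^sup>2 = CARD('a) \<and> polar_form scale Basis h (\<lambda>x. h x x = 0) CARD('a) q0 \<and>
    totally_isotropic_subspaces h = Collect (polar_form.tsing scale h (\<lambda>x. h x x = 0))"
proof -
  obtain q0 where q0: "q0\<^sup>2 = CARD('a)" and conj: "\<And>x y. h y x = h x y ^ q0"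
    using assms(1) by (auto simp: hermitian_form_def)
  have left: "h (x + y) z = h x z + h y z" "h (scale c x) z = c * h x z" for x y z c
    using assms(1) linear_functionalD[of "\<lambda>x. h x z"] by (auto simp: hermitian_form_def)
  note pow_add = power_add_if_square_card[OF q0]
  have right: "h z (x + y) = h z x + h z y" for x y z
    using conj[of z "x + y"] conj[of z x] conj[of z y] by (simp add: left pow_add)
  have pos: "q0 > 0"
    using q0 by (intro gr0I) simp
  have sym: "h y x = 0" if "h x y = 0" for x y
    using conj[of y x] that pos by simp
  have zero: "h 0 z = 0" for z
    using left(2)[of 0 0 z] by simp
  have pf: "polar_form scale Basis h (\<lambda>x. h x x = 0) CARD('a) q0"
  proof unfold_locales
    fix S s y
    assume S: "subspace S" "\<And>x y. x \<in> S \<Longrightarrow> y \<in> S \<Longrightarrow> h x x = 0 \<and> h x y = 0" "s \<in> S" "h s y \<noteq> 0"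
    let ?A = "{a. a + a ^ q0 = - h y y}"
    have "(- h y y) ^ q0 = - h y y"
      using pow_add[of "h y y" "- h y y"] conj[of y y] pos
      by (simp add: power_0_left eq_neg_iff_add_eq_0 add.commute)
    then have A: "card ?A = q0"
      by (rule card_trace_fibre[OF q0])
    have "h (y + s) (y + s) = h s y + h s y ^ q0 + h y y" if "s \<in> S" for s
      using S(2)[OF that that] unfolding left right conj[where x = s and y = y] by (simp add: add_ac)
    then have "{s \<in> S. h (y + s) (y + s) = 0} = {s \<in> S. h s y \<in> ?A}"
      by (auto simp: eq_neg_iff_add_eq_0)
    moreover have "(\<Sum>s\<in>{s \<in> S. h s y \<in> ?A}. card {a \<in> ?A. h s y = a}) = (\<Sum>a\<in>?A. card {s \<in> S. h s y = a})"
      by (rule sum_multicount_gen) (auto simp: finite_vectors intro!: arg_cong[of _ _ card])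
    moreover have "(\<Sum>s\<in>{s \<in> S. h s y \<in> ?A}. card {a \<in> ?A. h s y = a}) = card {s \<in> S. h s y \<in> ?A}"
    proof -
      have "card {a \<in> ?A. h s y = a} = 1" if "h s y \<in> ?A" for s
      proof -
        have "{a \<in> ?A. h s y = a} = {h s y}"
          using that by auto
        then show ?thesis
          by simp
      qed
      then have "(\<Sum>s\<in>{s \<in> S. h s y \<in> ?A}. card {a \<in> ?A. h s y = a}) = (\<Sum>s\<in>{s \<in> S. h s y \<in> ?A}. 1)"
        by (intro sum.cong) auto
      then show ?thesis
        by simp
    qed
    ultimately have "CARD('a) * card {s \<in> S. h (y + s) (y + s) = 0} =
        (\<Sum>a\<in>?A. CARD('a) * card {s \<in> S. h s y = a})"
      unfolding sum_distrib_left[symmetric] by simp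
    also have "\<dots> = q0 * card S"
      using card_functional_fibre[of S "\<lambda>x. h x y" s] S left A by simp
    finally show "CARD('a) * card {s \<in> S. h (y + s) (y + s) = 0} = q0 * card S" .
  next
    fix c x assume "h x x = 0"
    then have "h x (scale c x) = 0"
      by (simp add: left sym[of "scale c x" x])
    then show "h (scale c x) (scale c x) = 0"
      by (simp add: left)
  qed (use assms(2) sym in \<open>auto simp: left right zero nondegenerate_def\<close>)
  then interpret polar_form scale Basis h "\<lambda>x. h x x = 0" "CARD('a)" q0 .
  have "totally_isotropic_subspaces h = Collect tsing"
    by (auto simp: totally_isotropic_subspaces_def tsing_def)
  with q0 pf show ?thesis
    by blast
qed

end

lemma polar_form_of_rankI:
  fixes scale :: "'a::{field,finite} \<Rightarrow> 'v::ab_group_add \<Rightarrow> 'v"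
  assumes "polar_form scale Basis B sing CARD('a) \<kappa>"
    and Q: "\<Q> = Collect (polar_form.tsing scale B sing)"
    and rank: "finite_field_space.polar_rank scale \<Q> = r"
    and \<kappa>: "real \<kappa> = real CARD('a) powr d"
    and dim: "d + real (vector_space.dim scale (UNIV :: 'v set)) = 2 * real r + 1 + \<epsilon>"
  shows "polar_form_of_rank scale Basis B sing CARD('a) \<kappa> r (real CARD('a) powr (real r + \<epsilon>))"
proof -
  interpret polar_form scale Basis B sing "CARD('a)" \<kappa>
    by fact
  let ?q = "real CARD('a)"
  have fin: "finite (dim ` Collect tsing)" and ne: "dim ` Collect tsing \<noteq> {}"
    using tsing_zero finite_subspaces by auto
  have r: "Max (dim ` Collect tsing) = r"
    using rank by (simp add: Q polar_rank_def)
  have q: "?q > 0"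
    using q_ge_2 by simp
  show ?thesis
  proof
    show "\<exists>U. tsing U \<and> dim U = r"
      using Max_in[OF fin ne] r by auto
    show "dim U \<le> r" if "tsing U" for U
      using Max_ge[OF fin, of "dim U"] r that by auto
    have "real \<kappa> * ?q ^ dim UNIV = ?q powr (d + dim UNIV)"
      using q by (simp add: \<kappa> powr_add powr_realpow)
    also have "\<dots> = ?q powr (real r + \<epsilon> + real (Suc r))"
      unfolding dim by (simp add: algebra_simps)
    also have "\<dots> = ?q powr (real r + \<epsilon>) * ?q ^ Suc r"
      using q by (simp only: powr_add powr_realpow)
    finally show "real \<kappa> * ?q ^ dim UNIV = ?q powr (real r + \<epsilon>) * ?q ^ Suc r" .
    show "?q powr (real r + \<epsilon>) > 0"
      using q by simp
  qed
qed

lemma (in finite_classical_polar_space) polar_form_exists: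
  "\<exists>B sing \<kappa>. polar_form_of_rank scale Basis B sing CARD('a) \<kappa> r (real CARD('a) powr (real r + polar_eps ty)) \<and>
    \<Q> = Collect (polar_form.tsing scale B sing)"
proof -
  have q: "real CARD('a) powr 1 = real CARD('a)" "real CARD('a) powr 0 = 1"
    by simp_all
  note I = polar_form_of_rankI[OF _ _ rank]
  have sqrt: "real q0 = real CARD('a) powr (1 / 2)" if "q0\<^sup>2 = CARD('a)" for q0
    using that by (metis of_nat_power powr_half_sqrt of_nat_0_le_iff real_sqrt_unique)
  show ?thesis
  proof (cases ty)
    case Symplectic
    then obtain B where B: "alternating_form B" "nondegenerate B" "\<Q> = totally_isotropic_subspaces B"
      using form_kind by auto
    note pf = polar_form_alternating[OF B(1,2)]
    show ?thesis
      using I[OF pf(1), of 1 "polar_eps ty"] pf(2) B(3) dim_ambient Symplectic by auto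
  next
    case Hermitian_plus
    then obtain h where h: "hermitian_form h" "nondegenerate h" "\<Q> = totally_isotropic_subspaces h"
      using form_kind by auto
    from polar_form_hermitian[OF h(1,2)] obtain q0 where pf: "q0\<^sup>2 = CARD('a)"
      "polar_form scale Basis h (\<lambda>x. h x x = 0) CARD('a) q0"
      "totally_isotropic_subspaces h = Collect (polar_form.tsing scale h (\<lambda>x. h x x = 0))"
      by blast
    show ?thesis
      using I[OF pf(2), of "1/2" "polar_eps ty"] pf(3) h(3) dim_ambient sqrt[OF pf(1)] Hermitian_plus by auto
  next
    case Hermitian_minus
    then obtain h where h: "hermitian_form h" "nondegenerate h" "\<Q> = totally_isotropic_subspaces h"
      using form_kind by auto
    from polar_form_hermitian[OF h(1,2)] obtain q0 where pf: "q0\<^sup>2 = CARD('a)"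
      "polar_form scale Basis h (\<lambda>x. h x x = 0) CARD('a) q0"
      "totally_isotropic_subspaces h = Collect (polar_form.tsing scale h (\<lambda>x. h x x = 0))"
      by blast
    show ?thesis
      using I[OF pf(2), of "1/2" "polar_eps ty"] pf(3) h(3) dim_ambient sqrt[OF pf(1)] Hermitian_minus by auto
  next
    case Hyperbolic
    then obtain f where f: "quadratic_form f" "nonsingular f" "\<Q> = totally_singular_subspaces f"
      using form_kind by auto
    note pf = polar_form_quadratic[OF f(1,2)]
    show ?thesis
      using I[OF pf(1), of 0 "polar_eps ty"] pf(2) f(3) dim_ambient Hyperbolic by auto
  next
    case Parabolic
    then obtain f where f: "quadratic_form f" "nonsingular f" "\<Q> = totally_singular_subspaces f"
      using form_kind by auto
    note pf = polar_form_quadratic[OF f(1,2)]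
    show ?thesis
      using I[OF pf(1), of 0 "polar_eps ty"] pf(2) f(3) dim_ambient Parabolic by auto
  next
    case Elliptic
    then obtain f where f: "quadratic_form f" "nonsingular f" "\<Q> = totally_singular_subspaces f"
      using form_kind by auto
    note pf = polar_form_quadratic[OF f(1,2)]
    show ?thesis
      using I[OF pf(1), of 0 "polar_eps ty"] pf(2) f(3) dim_ambient Elliptic by auto
  qed
qed

theorem theorem18:
  fixes scale :: "'a::{field,finite} \<Rightarrow> 'v::ab_group_add \<Rightarrow> 'v"
    and Basis :: "'v set"
    and ty :: polar_type
    and \<Q> D :: "'v set set"
    and q r t k lam :: nat
    and \<epsilon> :: real
  assumes q: "q = CARD('a)"
    and eps: "\<epsilon> = polar_eps ty"
    and polar: "finite_classical_polar_space scale Basis ty r \<Q>"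
    and design: "finite_field_space.polar_design scale \<Q> t r k lam D"
    and lam: "lam \<ge> 1"
    and strength: "t \<ge> 2"
  shows "(k < r \<longrightarrow>
            real (card D) \<ge> polar_bracket1 q ty r \<and>
            card D \<ge> card (finite_field_space.polar_points scale \<Q>)) \<and>
         (k = r \<longrightarrow>
            card D \<ge> 1 + finite_field_space.polar_m1 scale \<Q> \<and>
            real (finite_field_space.polar_m1 scale \<Q>) =
              real q powr (\<epsilon> + 1)
              * ((real q powr (real r + \<epsilon> - 1) + 1) / (real q powr \<epsilon> + 1))
              * ((real q ^ r - 1) / (real q - 1)))"
proof -
  interpret finite_classical_polar_space scale Basis ty r \<Q>
    by (rule polar)
  define e where "e = real q powr (real r + \<epsilon>)"
  obtain B sing \<kappa> where "polar_form_of_rank scale Basis B sing CARD('a) \<kappa> r e"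
    and Q: "\<Q> = Collect (polar_form.tsing scale B sing)"
    using polar_form_exists by (auto simp: e_def q eps)
  then interpret form: polar_form_of_rank scale Basis B sing q \<kappa> r e
    by (simp add: q)
  have q1: "real q > 1"
    using form.q_ge_2 by simp
  have "t \<le> r"
    using design by (simp add: polar_design_def)
  then have r: "r \<ge> 2"
    using strength by simp
  note bounds = form.design_bounds[OF design[unfolded Q] lam strength, folded Q]
  have "real (card (polar_points \<Q>)) = polar_bracket1 q ty r"
    using form.card_points q1 unfolding Q[symmetric]
    by (simp add: polar_bracket1_def e_def eps field_simps)
  moreover have "real (polar_m1 \<Q>) = real q powr (\<epsilon> + 1)
      * ((real q powr (real r + \<epsilon> - 1) + 1) / (real q powr \<epsilon> + 1))
      * ((real q ^ r - 1) / (real q - 1))"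
  proof -
    define f where "f = real q powr \<epsilon>"
    define w where "w = real q ^ r"
    have f: "f > 0" and w: "w > 0"
      using q1 by (simp_all add: f_def w_def)
    have e: "e = w * f"
      using q1 by (simp add: e_def f_def w_def powr_add powr_realpow)
    have pow: "real q powr (\<epsilon> + 1) = f * q" "real q powr (real r + \<epsilon> - 1) = w * f / q"
      using q1 by (simp_all add: f_def w_def powr_add powr_diff powr_realpow)
    have "e * (q + e) / (w + e) = w * (f * (q + w * f)) / (w * (f + 1))"
      unfolding e by (simp add: algebra_simps)
    also have "\<dots> = f * (q + w * f) / (f + 1)"
      using w by (subst mult_divide_mult_cancel_left) auto
    also have "\<dots> = f * q * ((w * f / q + 1) / (f + 1))"
      using q1 by (simp add: distrib_left add.commute)
    finally show ?thesis
      using form.polar_m1_eq[OF r] unfolding Q[symmetric] pow f_def[symmetric] w_def[symmetric]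
      by (simp add: mult_ac)
  qed
  ultimately show ?thesis
    using bounds by auto
qed

end
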